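(* Let $m,n$ be positive integers and let $\phi:\mathbb{R}_+^n\to\mathbb{R}$ be a symmetric form that is monotone and concave on $\mathbb{R}_+^n$, extended to $\mathbf{H}_+^n$ by $\phi(A)=\phi(\boldsymbol{\lambda}(A))$. Then for any $K\in\mathbb{C}^{m\times n}$ and any $s\in(0,1]$, $p,q\in[0,1]$ with $p+q\le 1$, the function $$(A,B)\ \longmapsto\ \phi\Big(\big(B^{\frac{qs}{2}}K^*A^{ps}KB^{\frac{qs}{2}}\big)^{\frac1s}\Big)$$ is jointly concave on $\mathbf{H}_+^m\times\mathbf{H}_+^n$.
   Context: $\mathbb{R}_+^n=[0,+\infty)^n$. $\mathbf{H}_+^n$ is the convex cone of $n\times n$ complex Hermitian positive semidefinite matrices. Powers of positive semidefinite matrices are defined by the spectral functional calculus. For a Hermitian matrix $A$ of size $n$, $\boldsymbol{\lambda}(A)=(\lambda_1(A),\dots,\lambda_n(A))\in\mathbb{R}^n$ is the vector of its eigenvalues counted with multiplicity. A function $\phi:\mathbb{R}_+^n\to\mathbb{R}$ is a symmetric form if $\phi(P\boldsymbol{x})=\phi(\boldsymbol{x})$ for every $\boldsymbol{x}\in\mathbb{R}_+^n$ and every permutation $P\in S_n$ of the entries. It is monotone if $\boldsymbol{x}\ge\boldsymbol{y}$ (entrywise) implies $\phi(\boldsymbol{x})\ge\phi(\boldsymbol{y})$. It is concave if $\phi(\tau\boldsymbol{x}+(1-\tau)\boldsymbol{y})\ge\tau\phi(\boldsymbol{x})+(1-\tau)\phi(\boldsymbol{y})$ for all $\boldsymbol{x},\boldsymbol{y}\in\mathbb{R}_+^n$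 and $\tau\in[0,1]$. Its extension to $\mathbf{H}_+^n$ is $\phi(A)=\phi(\boldsymbol{\lambda}(A))$, which is well defined by permutation invariance. *)

theory Defs
  imports "HOL-Analysis.Analysis"
begin

definition ctranspose :: "complex^'n^'m \<Rightarrow> complex^'m^'n" where
  "ctranspose A = (\<chi> i j. cnj (A $ j $ i))"

definition hermitian :: "complex^'n^'n \<Rightarrow> bool" where
  "hermitian A \<longleftrightarrow> ctranspose A = A"

text \<open>For a Hermitian matrix the sum below is real, so taking the real part loses nothing.\<close>

definition psd_cone :: "(complex^'n^'n) set" where
  "psd_cone = {A. hermitian A \<and> (\<forall>x. 0 \<le> Re (\<Sum>i\<in>UNIV. cnj (x $ i) * (A *v x) $ i))}"

definition unitary :: "complex^'n^'n \<Rightarrow> bool" where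
  "unitary U \<longleftrightarrow> ctranspose U ** U = mat 1 \<and> U ** ctranspose U = mat 1"

definition diag_real :: "real^'n \<Rightarrow> complex^'n^'n" where
  "diag_real d = (\<chi> i j. if i = j then complex_of_real (d $ i) else 0)"

text \<open>Spectral functional calculus: \<open>f(A) = U diag(f(d)) U\<^sup>*\<close> for any unitary
  diagonalization \<open>A = U diag(d) U\<^sup>*\<close>. For Hermitian \<open>A\<close> such a diagonalization exists
  and the result does not depend on which one is used.\<close>

definition spectral_fun :: "(real \<Rightarrow> real) \<Rightarrow> complex^'n^'n \<Rightarrow> complex^'n^'n" where
  "spectral_fun f A = (THE B. \<exists>U d. unitary U \<and> A = U ** diag_real d ** ctranspose U \<and>
     B = U ** diag_real (\<chi> i. f (d $ i)) ** ctranspose U)"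

text \<open>The case split fixes the convention \<open>t\<^sup>0 = 1\<close> also at \<open>t = 0\<close>, so that the zeroth
  power of a matrix is the identity; the library has \<open>0 powr 0 = 0\<close>.\<close>

definition psd_power :: "complex^'n^'n \<Rightarrow> real \<Rightarrow> complex^'n^'n" where
  "psd_power A r = spectral_fun (\<lambda>t. if r = 0 then 1 else t powr r) A"

text \<open>The eigenvalues with multiplicity are the roots of the characteristic polynomial
  \<open>det (z I - A)\<close>; the index type carries no order, so their arrangement is left arbitrary.\<close>

definition eigenvalue_vec :: "complex^'n^'n \<Rightarrow> real^'n" where
  "eigenvalue_vec A =
     (SOME l. \<forall>z. det (mat z - A) = (\<Prod>i\<in>UNIV. z - complex_of_real (l $ i)))"

definition nonneg_orthant :: "(real^'n) set" where
  "nonneg_orthant = {x. \<forall>i. 0 \<le> x $ i}"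

definition symmetric_form :: "(real^'n \<Rightarrow> real) \<Rightarrow> bool" where
  "symmetric_form \<phi> \<longleftrightarrow>
     (\<forall>x\<in>nonneg_orthant. \<forall>\<pi>. \<pi> permutes UNIV \<longrightarrow> \<phi> (\<chi> i. x $ \<pi> i) = \<phi> x)"

definition matrix_ext :: "(real^'n \<Rightarrow> real) \<Rightarrow> complex^'n^'n \<Rightarrow> real" where
  "matrix_ext \<phi> A = \<phi> (eigenvalue_vec A)"

end

theory Submission
  imports Defs "HOL-Real_Asymp.Real_Asymp"
begin

text \<open>
  Put \<open>a = ps\<close>, \<open>b = qs\<close> and \<open>N(A,B) = B\<^bsup>b/2\<^esup> K\<^sup>* A\<^sup>a K B\<^bsup>b/2\<^esup>\<close>. A symmetric, monotone, concave \<open>\<phi>\<close>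
  only sees the sums of the \<open>k\<close> smallest entries of its argument: if these sums are concave
  in a parameter for every \<open>k\<close>, then so is \<open>\<phi>\<close> (\<open>symmetric_concave_of_smallest_sum_concave\<close>).
  Since \<open>1/s = (p + q)/(a + b)\<close> and \<open>t \<mapsto> t\<^bsup>p+q\<^esup>\<close> is increasing and concave, the factor \<open>p + q\<close>
  of the exponent can be moved into \<open>\<phi>\<close>. It remains to prove that the sum of the \<open>k\<close> smallest
  eigenvalues of \<open>N(A,B)\<^bsup>1/(a+b)\<^esup>\<close> is jointly concave (\<open>smallest_sum_eigenvalues_concave\<close>).

  For \<open>a, b > 0\<close> and invertible \<open>B\<close> this sum is the infimum, over all matrices with \<open>R W = E\<close> and
  \<open>E R = R\<close> for a fixed coordinate projection \<open>E\<close> of rank \<open>k\<close>, of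
  \<open>a/(a+b) tr (W\<^sup>* K\<^sup>* A\<^sup>a K W)\<^bsup>1/a\<^esup> + b/(a+b) tr (R B\<^sup>b R\<^sup>*)\<^bsup>1/b\<^esup>\<close>.
  This separates \<open>A\<close> from \<open>B\<close>, both summands are concave by Epstein's theorem, and an
  infimum of concave functions is concave. That the infimum is not smaller
  (\<open>smallest_sum_variational_le\<close>) combines an eigenvalue comparison for an oblique projection of
  rank \<open>k\<close> with the trace Hoelder inequality; pairs that come arbitrarily close
  (\<open>smallest_sum_variational_attained\<close>) are built from the eigenvectors of \<open>N(A,B)\<close>.

  Epstein's theorem, the concavity of \<open>A \<mapsto> tr (K\<^sup>* A\<^sup>a K)\<^bsup>1/a\<^esup>\<close>, follows from Lieb's theorem by
  writing \<open>a tr X\<^bsup>1/a\<^esup>\<close> as the maximum over \<open>Z\<close> of \<open>tr (X Z\<^bsup>1-a\<^esup>) - (1-a) tr Z\<close>. Lieb's theorem, the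
  joint concavity of \<open>tr (K\<^sup>* A\<^sup>p K Z\<^bsup>1-p\<^esup>)\<close>, holds because \<open>x\<^sup>p z\<^bsup>1-p\<^esup>\<close> is a positive superposition of the
  parallel sums \<open>x u z / (x + u z)\<close>, and a parallel sum is an infimum of linear functions.

  Zero exponents and singular \<open>B\<close> are reached by the regularization \<open>A + \<epsilon>\<close>, \<open>B + \<epsilon>\<close>,
  \<open>(a + \<epsilon>)/(1 + 2\<epsilon>)\<close>, \<open>(b + \<epsilon>)/(1 + 2\<epsilon>)\<close>. The limit is taken in the sums of eigenvalues,
  which are continuous, and not in \<open>\<phi>\<close>, which may jump at the boundary of the orthant.
\<close>

section \<open>Conjugate transposes and the Hermitian inner product\<close>

definition cinner :: "complex^'n \<Rightarrow> complex^'n \<Rightarrow> complex" where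
  "cinner x y = (\<Sum>i\<in>UNIV. cnj (x $ i) * y $ i)"

lemma ctranspose_nth [simp]: "ctranspose A $ i $ j = cnj (A $ j $ i)"
  by (simp add: ctranspose_def)

lemma ctranspose_mult: "ctranspose (A ** B) = ctranspose B ** ctranspose A"
  by (simp add: vec_eq_iff matrix_matrix_mult_def mult.commute)

lemma ctranspose_ctranspose [simp]: "ctranspose (ctranspose A) = A"
  by (simp add: vec_eq_iff)

lemma ctranspose_add: "ctranspose (A + B) = ctranspose A + ctranspose B"
  by (simp add: vec_eq_iff)

lemma ctranspose_scaleR: "ctranspose (c *\<^sub>R A) = c *\<^sub>R ctranspose A"
  by (simp add: vec_eq_iff)

lemma ctranspose_diag_real [simp]: "ctranspose (diag_real d) = diag_real d"
  by (auto simp: vec_eq_iff diag_real_def)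

lemma ctranspose_mat_1 [simp]: "ctranspose (mat 1) = (mat 1 :: complex^'n^'n)"
  by (auto simp: vec_eq_iff mat_def)

lemma diag_real_1: "diag_real (\<chi> i. 1) = mat 1"
  by (auto simp: vec_eq_iff diag_real_def mat_def)

lemma diag_real_mult: "diag_real d ** diag_real e = diag_real (\<chi> i. d $ i * e $ i)"
  by (simp add: vec_eq_iff diag_real_def matrix_matrix_mult_def if_distrib[of "\<lambda>x. x * _"]
      if_distrib[of "\<lambda>x. _ * x"] sum.delta cong: if_cong)

lemma mult_diag_real_nth: "(A ** diag_real d) $ i $ j = A $ i $ j * of_real (d $ j)"
  by (simp add: diag_real_def matrix_matrix_mult_def if_distrib[of "\<lambda>x. _ * x"]
      sum.delta cong: if_cong)

lemma diag_real_mult_nth: "(diag_real d ** A) $ i $ j = of_real (d $ i) * A $ i $ j"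
  by (simp add: diag_real_def matrix_matrix_mult_def if_distrib[of "\<lambda>x. x * _"]
      sum.delta cong: if_cong)

lemma scaleR_matrix_mult: "(c *\<^sub>R A) ** B = c *\<^sub>R (A ** B)" for A :: "complex^'n^'m"
  by (simp add: vec_eq_iff matrix_matrix_mult_def scaleR_sum_right)

lemma matrix_mult_scaleR: "A ** (c *\<^sub>R B) = c *\<^sub>R (A ** B)" for A :: "complex^'n^'m"
  by (simp add: vec_eq_iff matrix_matrix_mult_def scaleR_sum_right)

lemma matrix_diff_ldistrib: "A ** (B - C) = A ** B - A ** C" for A :: "complex^'n^'m"
  by (simp add: vec_eq_iff matrix_matrix_mult_def right_diff_distrib sum_subtractf)

lemma matrix_diff_rdistrib: "(A - B) ** C = A ** C - B ** C" for A :: "complex^'n^'m"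
  by (simp add: vec_eq_iff matrix_matrix_mult_def left_diff_distrib sum_subtractf)

lemma Re_trace_scaleR: "Re (trace (c *\<^sub>R A)) = c * Re (trace A)" for A :: "complex^'n^'n"
  by (simp add: trace_def sum_distrib_left)

lemma cinner_adjoint: "cinner x (A *v y) = cinner (ctranspose A *v x) y"
  unfolding cinner_def matrix_vector_mult_def
  by (simp add: sum_distrib_left sum_distrib_right mult_ac)
     (rule sum.swap)

lemma cinner_commute: "cinner y x = cnj (cinner x y)"
  by (simp add: cinner_def mult.commute)

lemma cinner_add_right: "cinner x (y + z) = cinner x y + cinner x z"
  by (simp add: cinner_def distrib_left sum.distrib)

lemma cinner_diff_right: "cinner x (y - z) = cinner x y - cinner x z"
  by (simp add: cinner_def right_diff_distrib sum_subtractf)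

lemma cinner_scaleR_right: "cinner x (c *\<^sub>R y) = c *\<^sub>R cinner x y"
  by (simp add: cinner_def scaleR_sum_right)

lemma cinner_scaleR_left: "cinner (c *\<^sub>R x) y = c *\<^sub>R cinner x y"
  by (simp add: cinner_def scaleR_sum_right)

lemma Re_cinner: "Re (cinner x y) = x \<bullet> y"
  by (simp add: cinner_def inner_vec_def inner_complex_def)

lemma cinner_self: "cinner x x = of_real ((norm x)\<^sup>2)"
proof -
  have "cnj (cinner x x) = cinner x x"
    using cinner_commute[of x x] by simp
  then have "Im (cinner x x) = 0"
    by (simp add: complex_eq_iff)
  then show ?thesis
    by (simp add: complex_eq_iff Re_cinner power2_norm_eq_inner)
qed

lemma hermitian_cinner: "hermitian A \<Longrightarrow> cinner x (A *v y) = cinner (A *v x) y"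
  by (simp add: hermitian_def cinner_adjoint)

lemma hermitian_inner: "hermitian A \<Longrightarrow> x \<bullet> (A *v y) = (A *v x) \<bullet> y"
  using hermitian_cinner[of A x y] by (simp flip: Re_cinner)

lemma psd_cone_iff: "A \<in> psd_cone \<longleftrightarrow> hermitian A \<and> (\<forall>x. 0 \<le> x \<bullet> (A *v x))"
  by (simp add: psd_cone_def flip: Re_cinner) (simp add: cinner_def)

lemma psd_cone_hermitian: "A \<in> psd_cone \<Longrightarrow> hermitian A"
  by (simp add: psd_cone_iff)

lemma psd_cone_congruence:
  fixes A :: "complex^'m^'m" and K :: "complex^'n^'m"
  assumes "A \<in> psd_cone"
  shows "ctranspose K ** A ** K \<in> psd_cone"
proof -
  have "cinner x ((ctranspose K ** A ** K) *v x) = cinner (K *v x) (A *v (K *v x))" for x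
    by (simp add: cinner_adjoint[of "K *v x"] cinner_adjoint[of x] ctranspose_mult
        flip: matrix_vector_mul_assoc)
  then have "x \<bullet> ((ctranspose K ** A ** K) *v x) = (K *v x) \<bullet> (A *v (K *v x))" for x
    by (simp flip: Re_cinner)
  with assms show ?thesis
    by (simp add: psd_cone_iff hermitian_def ctranspose_mult matrix_mul_assoc)
qed

lemma matrix_vector_mult_scaleR_left: "(c *\<^sub>R A) *v x = c *\<^sub>R (A *v x)" for A :: "complex^'n^'m"
  by (simp add: vec_eq_iff matrix_vector_mult_def scaleR_sum_right)

lemma matrix_vector_mult_scaleR_right: "A *v (c *\<^sub>R x) = c *\<^sub>R (A *v x)" for A :: "complex^'n^'m"
  by (simp add: vec_eq_iff matrix_vector_mult_def scaleR_sum_right)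

lemma convex_psd_cone: "convex psd_cone"
  by (rule convexI)
     (simp add: psd_cone_iff hermitian_def ctranspose_add ctranspose_scaleR
       matrix_vector_mult_add_rdistrib matrix_vector_mult_scaleR_left inner_add_right)

section \<open>The spectral theorem\<close>

text \<open>Fewer linear equations than unknowns. Injecting the index set into the coordinates gives a
  square matrix with a zero row. All dimension counts below go through this lemma.\<close>

lemma homogeneous_system:
  fixes r :: "'j \<Rightarrow> complex^'n"
  assumes "finite J" and "card J < CARD('n)"
  shows "\<exists>x. x \<noteq> 0 \<and> (\<forall>j\<in>J. cinner (r j) x = 0)"
proof -
  obtain g :: "'j \<Rightarrow> 'n" where g: "inj_on g J"
    using assms card_le_inj[of J "UNIV :: 'n set"] by auto
  have "g ` J \<noteq> UNIV"
    using g assms(2) card_image[OF g] by auto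
  then obtain k where k: "k \<notin> g ` J"
    by auto
  define M :: "complex^'n^'n" where
    "M = (\<chi> i l. if i \<in> g ` J then cnj (r (the_inv_into J g i) $ l) else 0)"
  have "row k M = 0"
    using k by (simp add: row_def M_def vec_eq_iff)
  then have "det M = 0"
    by (rule det_zero_row)
  then have "\<not> (\<exists>B. B ** M = mat 1)"
    by (simp add: invertible_det_nz flip: invertible_left_inverse)
  then obtain x where x: "M *v x = 0" "x \<noteq> 0"
    using matrix_left_invertible_ker[of M] by auto
  have "cinner (r j) x = 0" if "j \<in> J" for j
  proof -
    have "(M *v x) $ g j = cinner (r j) x"
      using that g by (simp add: matrix_vector_mult_def M_def cinner_def the_inv_into_f_f)
    with x show ?thesis
      by simp
  qed
  with x show ?thesis
    by auto
qed

text \<open>The Rayleigh quotient attains its maximum on the unit sphere of the orthogonal complement of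
  the given eigenvectors, a complement that \<open>A\<close> leaves invariant; a maximizer is an eigenvector.\<close>

lemma hermitian_eigenvector_orthogonal:
  fixes A :: "complex^'n^'n" and e :: "'j \<Rightarrow> complex^'n"
  assumes A: "hermitian A" and J: "finite J" "card J < CARD('n)"
    and e: "\<And>j. j \<in> J \<Longrightarrow> A *v e j = d j *\<^sub>R e j"
  shows "\<exists>x l. norm x = 1 \<and> (\<forall>j\<in>J. cinner (e j) x = 0) \<and> A *v x = l *\<^sub>R x"
proof -
  define S where "S = {x. \<forall>j\<in>J. cinner (e j) x = 0}"
  have contc: "continuous_on UNIV (\<lambda>x. cinner y x)" for y :: "complex^'n"
    unfolding cinner_def by (intro continuous_intros)
  have contA: "continuous_on UNIV (\<lambda>x. x \<bullet> (A *v x))"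
    by (intro continuous_intros linear_continuous_on linear_conv_bounded_linear[THEN iffD1]) simp
  have "closed S"
    unfolding S_def Ball_def
    by (intro closed_Collect_all closed_Collect_imp closed_Collect_eq open_Collect_const contc continuous_intros)
  then have comp: "compact (sphere 0 1 \<inter> S)"
    by (intro compact_Int_closed) auto
  obtain z where z: "z \<noteq> 0" "z \<in> S"
    using homogeneous_system[OF J, of e] by (auto simp: S_def)
  have "(1 / norm z) *\<^sub>R z \<in> sphere 0 1 \<inter> S"
    using z by (simp add: S_def cinner_scaleR_right)
  then have ne: "sphere 0 1 \<inter> S \<noteq> {}"
    by blast
  obtain x where x: "x \<in> sphere 0 1 \<inter> S"
    and max: "\<And>y. y \<in> sphere 0 1 \<inter> S \<Longrightarrow> y \<bullet> (A *v y) \<le> x \<bullet> (A *v x)"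
    using continuous_attains_sup[OF comp ne continuous_on_subset[OF contA]] by auto
  define l where "l = x \<bullet> (A *v x)"
  have nx: "norm x = 1" "x \<in> S"
    using x by auto
  have bound: "y \<bullet> (A *v y) \<le> l * (y \<bullet> y)" if "y \<in> S" for y
  proof (cases "y = 0")
    case False
    have "(1 / norm y) *\<^sub>R y \<in> sphere 0 1 \<inter> S"
      using that False by (simp add: S_def cinner_scaleR_right)
    from max[OF this] have "(y \<bullet> (A *v y)) / (norm y)\<^sup>2 \<le> l"
      by (simp add: l_def matrix_vector_mult_scaleR_right power2_eq_square divide_inverse mult_ac)
    then show ?thesis
      using False by (simp add: divide_le_eq power2_norm_eq_inner)
  qed simp
  define w where "w = A *v x - l *\<^sub>R x"
  have wS: "w \<in> S"
  proof -
    have "cinner (e j) (A *v x) = 0" if "j \<in> J" for j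
      using that nx e by (simp add: hermitian_cinner[OF A] cinner_scaleR_left S_def)
    then show ?thesis
      using nx by (simp add: S_def w_def cinner_diff_right cinner_scaleR_right)
  qed
  \<comment> \<open>First-order optimality of the Rayleigh quotient at \<open>x\<close> in the direction \<open>w\<close>.\<close>
  have key: "2 * t * (w \<bullet> w) \<le> t\<^sup>2 * (l * (w \<bullet> w) - w \<bullet> (A *v w))" for t
  proof -
    have "x + t *\<^sub>R w \<in> S"
      using nx wS by (simp add: S_def cinner_add_right cinner_scaleR_right)
    from bound[OF this]
    have "x \<bullet> (A *v x) + 2 * t * (w \<bullet> (A *v x)) + t\<^sup>2 * (w \<bullet> (A *v w))
        \<le> l * (x \<bullet> x + 2 * t * (w \<bullet> x) + t\<^sup>2 * (w \<bullet> w))"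
      using hermitian_inner[OF A, of x w]
      by (simp add: matrix_vector_right_distrib matrix_vector_mult_scaleR_right inner_add_left
          inner_add_right inner_commute algebra_simps power2_eq_square)
    moreover have "x \<bullet> x = 1"
      using nx by (simp flip: power2_norm_eq_inner)
    moreover have "x \<bullet> (A *v x) = l"
      by (simp add: l_def)
    moreover have "w \<bullet> w = w \<bullet> (A *v x) - l * (w \<bullet> x)"
      using inner_diff_right[of w "A *v x" "l *\<^sub>R x"] by (simp flip: w_def)
    then have "2 * t * (w \<bullet> w) = 2 * t * (w \<bullet> (A *v x)) - 2 * t * l * (w \<bullet> x)"
      by (simp add: right_diff_distrib)
    ultimately show ?thesis
      by (simp add: distrib_left right_diff_distrib mult_ac)
  qed
  have "w \<bullet> w \<le> 0"
  proof (rule ccontr)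
    assume "\<not> w \<bullet> w \<le> 0"
    then have pos: "w \<bullet> w > 0"
      by linarith
    define c where "c = \<bar>l * (w \<bullet> w) - w \<bullet> (A *v w)\<bar> + 1"
    have c: "c > 0"
      by (simp add: c_def)
    \<comment> \<open>A step so short that the quadratic term cannot compensate the linear gain.\<close>
    define t where "t = (w \<bullet> w) / c"
    have t: "t > 0"
      using pos c by (simp add: t_def)
    have "2 * t * (w \<bullet> w) \<le> t\<^sup>2 * c"
      using order_trans[OF key[of t] mult_left_mono[of "l * (w \<bullet> w) - w \<bullet> (A *v w)" c "t\<^sup>2"]]
      by (simp add: c_def)
    also have "\<dots> = t * (w \<bullet> w)"
      using c by (simp add: t_def power2_eq_square)
    finally show False
      using t pos by simp
  qed
  then have "w = 0"
    by (metis inner_eq_zero_iff inner_ge_zero order_antisym)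
  then show ?thesis
    using nx by (auto simp: w_def S_def)
qed

text \<open>A unitary diagonalization \<open>A = U diag(d) U\<^sup>*\<close>. Every spectral quantity below is computed from
  such a triple.\<close>

definition spectral :: "complex^'n^'n \<Rightarrow> real^'n \<Rightarrow> complex^'n^'n \<Rightarrow> bool" where
  "spectral U d A \<longleftrightarrow> unitary U \<and> A = U ** diag_real d ** ctranspose U"

lemma orthonormal_eigenvectors:
  fixes A :: "complex^'n^'n" and I :: "'n set"
  assumes "hermitian A"
  shows "\<exists>e d. (\<forall>i\<in>I. A *v e i = d i *\<^sub>R e i) \<and>
    (\<forall>i\<in>I. \<forall>j\<in>I. cinner (e i) (e j) = (if i = j then 1 else 0))"
proof (induction I rule: finite_induct[OF finite])
  case (2 k I)
  then obtain e d where e: "\<forall>i\<in>I. A *v e i = d i *\<^sub>R e i"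
    "\<forall>i\<in>I. \<forall>j\<in>I. cinner (e i) (e j) = (if i = j then 1 else 0)"
    by blast
  have "card I < CARD('n)"
    using 2 by (metis finite_class.finite_UNIV psubset_card_mono psubsetI subset_UNIV UNIV_I)
  then obtain x l where x: "norm x = 1" "\<forall>j\<in>I. cinner (e j) x = 0" "A *v x = l *\<^sub>R x"
    using hermitian_eigenvector_orthogonal[OF assms, of I e d] e 2 by auto
  have "cinner x x = 1"
    using x(1) by (simp add: cinner_self)
  moreover have "\<forall>j\<in>I. cinner x (e j) = 0"
    using x(2) cinner_commute by (metis complex_cnj_zero)
  ultimately show ?case
    using e x 2 by (intro exI[of _ "e(k := x)"] exI[of _ "d(k := l)"]) auto
qed auto

theorem spectral_theorem:
  fixes A :: "complex^'n^'n"
  assumes "hermitian A"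
  obtains U d where "spectral U d A"
proof -
  obtain e :: "'n \<Rightarrow> complex^'n" and d where e: "\<And>i. A *v e i = d i *\<^sub>R e i"
    and o: "\<And>i j. cinner (e i) (e j) = (if i = j then 1 else 0)"
    using orthonormal_eigenvectors[OF assms, of UNIV] by (metis UNIV_I)
  define U :: "complex^'n^'n" where "U = (\<chi> i j. e j $ i)"
  have UU: "ctranspose U ** U = mat 1"
    using o by (simp add: vec_eq_iff matrix_matrix_mult_def U_def cinner_def mat_def)
  then have UU': "U ** ctranspose U = mat 1"
    by (simp add: matrix_left_right_inverse)
  have "A ** U = U ** diag_real (\<chi> i. d i)"
  proof -
    have "(A ** U) $ i $ j = (A *v e j) $ i" for i j
      by (simp add: matrix_matrix_mult_def matrix_vector_mult_def U_def)
    then show ?thesis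
      by (simp add: vec_eq_iff mult_diag_real_nth e U_def)
         (simp add: scaleR_conv_of_real mult.commute)
  qed
  then have "A = U ** diag_real (\<chi> i. d i) ** ctranspose U"
    by (metis UU' matrix_mul_assoc matrix_mul_rid)
  with UU UU' have "spectral U (\<chi> i. d i) A"
    by (simp add: spectral_def unitary_def)
  then show thesis
    by (rule that)
qed

lemma spec_diag:
  assumes "spectral U d A"
  shows "ctranspose U ** A ** U = diag_real d"
proof -
  have "ctranspose U ** A ** U = (ctranspose U ** U) ** diag_real d ** (ctranspose U ** U)"
    using assms by (simp add: spectral_def matrix_mul_assoc)
  with assms show ?thesis
    by (simp add: spectral_def unitary_def)
qed

lemma spec_eigenvector:
  assumes "spectral U d A"
  shows "A *v column i U = d $ i *\<^sub>R column i U"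
proof -
  have "A ** U = U ** diag_real d"
    using assms unfolding spectral_def unitary_def by (metis matrix_mul_assoc matrix_mul_rid)
  then have "(A *v column i U) $ k = U $ k $ i * of_real (d $ i)" for k
    using mult_diag_real_nth[of U d k i]
    by (simp add: column_def matrix_matrix_mult_def matrix_vector_mult_def vec_eq_iff)
  then show ?thesis
    by (simp add: vec_eq_iff column_def) (simp add: scaleR_conv_of_real)
qed

lemma unitary_columns:
  assumes "unitary U"
  shows "cinner (column i U) (column j U) = (if i = j then 1 else 0)"
proof -
  have "(ctranspose U ** U) $ i $ j = cinner (column i U) (column j U)"
    by (simp add: matrix_matrix_mult_def cinner_def column_def)
  with assms show ?thesis
    by (simp add: unitary_def mat_def)
qed

lemma spec_psd_nonneg:
  assumes "spectral U d A" and "A \<in> psd_cone"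
  shows "0 \<le> d $ i"
proof -
  have "column i U \<bullet> column i U = 1"
    using unitary_columns[of U i i] assms(1) by (simp add: spectral_def flip: Re_cinner)
  then have "column i U \<bullet> (A *v column i U) = d $ i"
    by (simp add: spec_eigenvector[OF assms(1)])
  with assms(2) show ?thesis
    by (simp add: psd_cone_iff) metis
qed

lemma diag_real_psd:
  assumes "\<And>i. 0 \<le> d $ i"
  shows "diag_real d \<in> psd_cone"
proof -
  have "x \<bullet> (diag_real d *v x) = (\<Sum>i\<in>UNIV. d $ i * (x $ i \<bullet> x $ i))" for x
    by (simp add: inner_vec_def matrix_vector_mult_def diag_real_def if_distrib[of "\<lambda>x. x * _"]
        cong: if_cong) (simp flip: scaleR_conv_of_real)
  then show ?thesis
    using assms by (simp add: psd_cone_iff hermitian_def sum_nonneg)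
qed

lemma spec_psd:
  assumes "spectral U d A" and "\<And>i. 0 \<le> d $ i"
  shows "A \<in> psd_cone"
  using psd_cone_congruence[OF diag_real_psd[of d], of "ctranspose U"] assms
  by (simp add: spectral_def)

text \<open>With \<open>T = V\<^sup>* U\<close>, equality of the two diagonalizations says that \<open>T\<^bsub>ij\<^esub> \<noteq> 0\<close> only where
  \<open>e\<^sub>i = d\<^sub>j\<close>, and this relation survives the application of any function to both spectra.\<close>

lemma functional_calculus_unique:
  assumes "spectral U d A" and "spectral V e A"
  shows "U ** diag_real (\<chi> i. f (d $ i)) ** ctranspose U
    = V ** diag_real (\<chi> i. f (e $ i)) ** ctranspose V"
proof -
  define T where "T = ctranspose V ** U"
  have U: "ctranspose U ** U = mat 1" "U ** ctranspose U = mat 1"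
    and V: "ctranspose V ** V = mat 1" "V ** ctranspose V = mat 1"
    using assms by (auto simp: spectral_def unitary_def)
  have "T ** diag_real d = diag_real e ** T"
  proof -
    have "T ** diag_real d = ctranspose V ** (U ** diag_real d ** ctranspose U) ** U"
      using U by (simp add: T_def flip: matrix_mul_assoc)
    also have "\<dots> = ctranspose V ** (V ** diag_real e ** ctranspose V) ** U"
      using assms by (simp add: spectral_def)
    also have "\<dots> = diag_real e ** T"
      using V by (simp add: T_def matrix_mul_assoc)
    finally show ?thesis .
  qed
  then have "T $ i $ j * of_real (d $ j) = of_real (e $ i) * T $ i $ j" for i j
    by (metis mult_diag_real_nth diag_real_mult_nth)
  then have "T $ i $ j = 0 \<or> d $ j = e $ i" for i j
    by (metis mult.commute mult_cancel_right of_real_eq_iff)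
  then have "T $ i $ j * of_real (f (d $ j)) = of_real (f (e $ i)) * T $ i $ j" for i j
    by (metis mult.commute mult_zero_right)
  then have T: "T ** diag_real (\<chi> i. f (d $ i)) = diag_real (\<chi> i. f (e $ i)) ** T"
    by (simp add: vec_eq_iff mult_diag_real_nth diag_real_mult_nth)
  have "U = V ** T"
    using V by (simp add: T_def matrix_mul_assoc)
  then have "U ** diag_real (\<chi> i. f (d $ i)) = V ** diag_real (\<chi> i. f (e $ i)) ** T"
    using T by (metis matrix_mul_assoc)
  moreover have "T ** ctranspose U = ctranspose V"
    using U by (simp add: T_def flip: matrix_mul_assoc)
  ultimately show ?thesis
    by (metis matrix_mul_assoc)
qed

lemma spectral_fun_spec:
  assumes "spectral U d A"
  shows "spectral_fun f A = U ** diag_real (\<chi> i. f (d $ i)) ** ctranspose U"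
  unfolding spectral_fun_def
proof (rule the_equality)
  show "\<exists>U' d'. unitary U' \<and> A = U' ** diag_real d' ** ctranspose U' \<and>
      U ** diag_real (\<chi> i. f (d $ i)) ** ctranspose U =
      U' ** diag_real (\<chi> i. f (d' $ i)) ** ctranspose U'"
    using assms by (auto simp: spectral_def)
qed (metis assms functional_calculus_unique spectral_def)

text \<open>Real powers with the convention \<open>0\<^sup>0 = 1\<close> of the matrix powers.\<close>

definition zpowr :: "real \<Rightarrow> real \<Rightarrow> real" where
  "zpowr t r = (if r = 0 then 1 else t powr r)"

lemma zpowr_nonneg [simp]: "0 \<le> zpowr t r"
  by (simp add: zpowr_def)

lemma spec_psd_power:
  assumes "spectral U d A"
  shows "spectral U (\<chi> i. zpowr (d $ i) r) (psd_power A r)"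
  using assms spectral_fun_spec[OF assms]
  by (simp add: spectral_def psd_power_def zpowr_def)

lemma psd_power_psd: "A \<in> psd_cone \<Longrightarrow> psd_power A r \<in> psd_cone"
  by (metis psd_cone_hermitian spec_psd spec_psd_power spectral_theorem vec_lambda_beta zpowr_nonneg)

section \<open>The vector of eigenvalues\<close>

lemma charpoly_spec:
  assumes "spectral U d A"
  shows "det (mat z - A) = (\<Prod>i\<in>UNIV. z - complex_of_real (d $ i))"
proof -
  have U: "U ** ctranspose U = mat 1" "unitary U"
    using assms by (auto simp: spectral_def unitary_def)
  define D where "D = mat z - diag_real d"
  have mz: "mat z ** X = X ** mat z" for X :: "complex^'n^'n"
    by (simp add: vec_eq_iff matrix_matrix_mult_def mat_def if_distrib[of "\<lambda>x. x * _"]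
        if_distrib[of "\<lambda>x. _ * x"] mult.commute cong: if_cong)
  have "U ** D ** ctranspose U = U ** mat z ** ctranspose U - A"
    using assms by (simp add: D_def spectral_def matrix_diff_ldistrib matrix_diff_rdistrib)
  also have "U ** mat z ** ctranspose U = mat z"
    by (metis U(1) mz matrix_mul_assoc matrix_mul_rid)
  finally have "mat z - A = U ** D ** ctranspose U" ..
  then have "det (mat z - A) = det D * det (U ** ctranspose U)"
    by (simp add: det_mul)
  also have "\<dots> = det D"
    using U by simp
  also have "\<dots> = (\<Prod>i\<in>UNIV. D $ i $ i)"
    by (rule det_diagonal) (simp add: D_def mat_def diag_real_def)
  finally show ?thesis
    by (simp add: D_def mat_def diag_real_def)
qed

text \<open>The entries, with multiplicity, are the roots of the polynomial and hence determined by it.\<close>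

lemma prod_linear_factors_permutes:
  fixes l d :: "real^'n"
  assumes "\<And>z. (\<Prod>i\<in>UNIV. z - complex_of_real (l $ i)) = (\<Prod>i\<in>UNIV. z - complex_of_real (d $ i))"
  shows "\<exists>\<pi>. \<pi> permutes UNIV \<and> (\<forall>i. l $ i = d $ \<pi> i)"
proof -
  let ?p = "\<lambda>l :: real^'n. \<Prod>i\<in>UNIV. [: - complex_of_real (l $ i), 1 :]"
  have "poly (?p l) = poly (?p d)"
    using assms by (auto simp: fun_eq_iff poly_prod)
  then have eq: "?p l = ?p d"
    by (simp add: poly_eq_poly_eq_iff)
  have "proots (?p l) = image_mset (\<lambda>i. complex_of_real (l $ i)) (mset_set UNIV)" for l
    by (subst proots_prod) (auto simp: sum_unfold_sum_mset)
  with eq have "image_mset (\<lambda>i. complex_of_real (l $ i)) (mset_set UNIV)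
      = image_mset (\<lambda>i. complex_of_real (d $ i)) (mset_set UNIV)"
    by metis
  from image_mset_eq_implies_permutes[OF _ this] show ?thesis
    by auto
qed

lemma eigenvalue_vec_spec:
  assumes "spectral U d A"
  shows "\<exists>\<pi>. \<pi> permutes UNIV \<and> (\<forall>i. eigenvalue_vec A $ i = d $ \<pi> i)"
proof -
  have "\<forall>z. det (mat z - A) = (\<Prod>i\<in>UNIV. z - complex_of_real (eigenvalue_vec A $ i))"
    unfolding eigenvalue_vec_def by (rule someI) (use charpoly_spec[OF assms] in blast)
  then show ?thesis
    by (intro prod_linear_factors_permutes) (simp flip: charpoly_spec[OF assms])
qed

lemma spec_permutes:
  assumes "spectral U d A" and "spectral V e A"
  shows "\<exists>\<pi>. \<pi> permutes UNIV \<and> (\<forall>i. d $ i = e $ \<pi> i)"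
  by (intro prod_linear_factors_permutes) (simp flip: charpoly_spec[OF assms(1)] charpoly_spec[OF assms(2)])

section \<open>Traces and traces of powers\<close>

definition trace_power :: "complex^'n^'n \<Rightarrow> real \<Rightarrow> real" where
  "trace_power A c = Re (trace (psd_power A c))"

lemma matrix_add_rdistrib: "(A + B) ** C = A ** C + B ** C" for A :: "complex^'n^'m"
  by (simp add: vec_eq_iff matrix_matrix_mult_def distrib_right sum.distrib)

lemma matrix_mult_nth: "(A ** B) $ i $ j = (\<Sum>k\<in>UNIV. A $ i $ k * B $ k $ j)"
  by (simp add: matrix_matrix_mult_def)

lemma Re_trace_add: "Re (trace (A + B)) = Re (trace A) + Re (trace B)"
  for A :: "complex^'n^'n"
  by (simp add: trace_def sum.distrib)

lemma trace_unitary_diag: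
  assumes "unitary U"
  shows "Re (trace (U ** diag_real f ** ctranspose U)) = (\<Sum>i\<in>UNIV. f $ i)"
proof -
  have "trace (U ** diag_real f ** ctranspose U) = trace (ctranspose U ** U ** diag_real f)"
    using trace_mul_sym[of "U ** diag_real f" "ctranspose U"] by (simp add: matrix_mul_assoc)
  also have "\<dots> = trace (diag_real f)"
    using assms by (simp add: unitary_def)
  finally show ?thesis
    by (simp add: trace_def diag_real_def)
qed

lemma trace_spec: "spectral U d A \<Longrightarrow> Re (trace A) = (\<Sum>i\<in>UNIV. d $ i)"
  by (auto simp: spectral_def trace_unitary_diag)

lemma trace_power_spec: "spectral U d A \<Longrightarrow> trace_power A c = (\<Sum>i\<in>UNIV. zpowr (d $ i) c)"
  unfolding trace_power_def by (drule spec_psd_power[where r = c], drule trace_spec) simp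

text \<open>In the eigenbases of \<open>A\<close> and \<open>Z\<close> the left multiplication by \<open>A\<close> and the right multiplication
  by \<open>Z\<close> are simultaneously diagonal; this turns trace inequalities into scalar ones.\<close>

lemma trace_double_sum:
  fixes U :: "complex^'m^'m" and V :: "complex^'n^'n" and K :: "complex^'n^'m"
  shows "Re (trace (ctranspose K ** (U ** diag_real f ** ctranspose U) ** K
      ** (V ** diag_real g ** ctranspose V)))
    = (\<Sum>i\<in>UNIV. \<Sum>j\<in>UNIV. (cmod ((ctranspose U ** K ** V) $ i $ j))\<^sup>2 * (f $ i * g $ j))"
proof -
  define G where "G = ctranspose U ** K ** V"
  have "trace (ctranspose K ** (U ** diag_real f ** ctranspose U) ** K
      ** (V ** diag_real g ** ctranspose V))
    = trace ((ctranspose G ** (diag_real f ** G)) ** diag_real g)"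
    using trace_mul_sym[of "ctranspose K ** (U ** diag_real f ** ctranspose U) ** K
      ** V ** diag_real g" "ctranspose V"]
    by (simp add: G_def ctranspose_mult matrix_mul_assoc)
  also have "Re \<dots> = (\<Sum>j\<in>UNIV. \<Sum>i\<in>UNIV. (cmod (G $ i $ j))\<^sup>2 * (f $ i * g $ j))"
    unfolding trace_def mult_diag_real_nth matrix_mult_nth[of "ctranspose G"] diag_real_mult_nth
    unfolding cmod_power2 by (simp add: sum_distrib_left sum_distrib_right algebra_simps power2_eq_square)
  also have "\<dots> = (\<Sum>i\<in>UNIV. \<Sum>j\<in>UNIV. (cmod (G $ i $ j))\<^sup>2 * (f $ i * g $ j))"
    by (rule sum.swap)
  finally show ?thesis
    by (simp add: G_def)
qed

lemma trace_spec_double_sum: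
  assumes "spectral U x A" and "spectral V z Z"
  shows "Re (trace (ctranspose K ** A ** K ** Z))
    = (\<Sum>i\<in>UNIV. \<Sum>j\<in>UNIV. (cmod ((ctranspose U ** K ** V) $ i $ j))\<^sup>2 * (x $ i * z $ j))"
  using assms trace_double_sum[of K U x V z] by (simp add: spectral_def)

lemma spec_mat_1: "unitary U \<Longrightarrow> spectral U (\<chi> i. 1) (mat 1)"
  by (simp add: spectral_def diag_real_1 unitary_def)

lemma spec_scaleR: "spectral U d A \<Longrightarrow> spectral U (c *\<^sub>R d) (c *\<^sub>R A)"
proof -
  have "diag_real (c *\<^sub>R d) = c *\<^sub>R diag_real d"
    by (simp add: vec_eq_iff diag_real_def) (simp add: scaleR_conv_of_real)
  then show "spectral U d A \<Longrightarrow> spectral U (c *\<^sub>R d) (c *\<^sub>R A)"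
    by (simp add: spectral_def scaleR_matrix_mult matrix_mult_scaleR)
qed

section \<open>Lieb's concavity theorem\<close>

text \<open>The quadratic form at \<open>K\<close> of the parallel sum of the commuting operators \<open>X \<mapsto> A X\<close> and
  \<open>X \<mapsto> X Z\<close>, written in eigenbases of \<open>A\<close> and \<open>Z\<close>.\<close>

definition parallel_form :: "complex^'m^'m \<Rightarrow> real^'m \<Rightarrow> complex^'n^'n \<Rightarrow> real^'n \<Rightarrow> complex^'n^'m \<Rightarrow> real" where
  "parallel_form U x V z K = (\<Sum>i\<in>UNIV. \<Sum>j\<in>UNIV.
     (cmod ((ctranspose U ** K ** V) $ i $ j))\<^sup>2 * (x $ i * z $ j / (x $ i + z $ j)))"

text \<open>After the triangle inequality, the difference of the two sides is a multiple of
  \<open>(x |u| - z |v|)\<^sup>2\<close>.\<close>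

lemma parallel_sum_le:
  fixes u v :: complex
  assumes "0 \<le> x" and "0 \<le> z"
  shows "(cmod (u + v))\<^sup>2 * (x * z / (x + z)) \<le> (cmod u)\<^sup>2 * x + (cmod v)\<^sup>2 * z"
proof (cases "x + z = 0")
  case False
  have "(cmod (u + v))\<^sup>2 * (x * z) \<le> (cmod u + cmod v)\<^sup>2 * (x * z)"
    using assms by (intro mult_right_mono power_mono norm_triangle_ineq) auto
  also have "\<dots> \<le> ((cmod u)\<^sup>2 * x + (cmod v)\<^sup>2 * z) * (x + z)"
    using zero_le_power2[of "x * cmod u - z * cmod v"]
    by (simp add: power2_eq_square algebra_simps)
  finally show ?thesis
    using False assms by (simp add: divide_le_eq)
qed (use assms in auto)

lemma parallel_form_le:
  assumes "spectral U x A" and "spectral V z Z" and "\<And>i. 0 \<le> x $ i" and "\<And>j. 0 \<le> z $ j"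
  shows "parallel_form U x V z (X + Y)
    \<le> Re (trace (ctranspose X ** A ** X)) + Re (trace (ctranspose Y ** Y ** Z))"
proof -
  have U: "unitary U" and V: "unitary V"
    using assms by (auto simp: spectral_def)
  have "Re (trace (ctranspose X ** A ** X)) = (\<Sum>i\<in>UNIV. \<Sum>j\<in>UNIV.
      (cmod ((ctranspose U ** X ** V) $ i $ j))\<^sup>2 * x $ i)"
    using trace_spec_double_sum[OF assms(1) spec_mat_1[OF V], of X] by simp
  moreover have "Re (trace (ctranspose Y ** Y ** Z)) = (\<Sum>i\<in>UNIV. \<Sum>j\<in>UNIV.
      (cmod ((ctranspose U ** Y ** V) $ i $ j))\<^sup>2 * z $ j)"
    using trace_spec_double_sum[OF spec_mat_1[OF U] assms(2), of Y] by simp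
  moreover have "(cmod ((ctranspose U ** (X + Y) ** V) $ i $ j))\<^sup>2 * (x $ i * z $ j / (x $ i + z $ j))
      \<le> (cmod ((ctranspose U ** X ** V) $ i $ j))\<^sup>2 * x $ i
        + (cmod ((ctranspose U ** Y ** V) $ i $ j))\<^sup>2 * z $ j" for i j
    using parallel_sum_le[OF assms(3)[of i] assms(4)[of j], of "(ctranspose U ** X ** V) $ i $ j"
        "(ctranspose U ** Y ** V) $ i $ j"]
    by (simp add: matrix_add_ldistrib matrix_add_rdistrib)
  ultimately show ?thesis
    unfolding parallel_form_def by (simp only: flip: sum.distrib) (intro sum_mono)
qed

lemma parallel_form_attained:
  assumes "spectral U x A" and "spectral V z Z" and "\<And>i. 0 \<le> x $ i" and "\<And>j. 0 \<le> z $ j"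
  obtains X Y where "X + Y = K" and
    "parallel_form U x V z K = Re (trace (ctranspose X ** A ** X)) + Re (trace (ctranspose Y ** Y ** Z))"
proof -
  have U: "unitary U" and V: "unitary V"
    using assms by (auto simp: spectral_def)
  define G where "G = ctranspose U ** K ** V"
  \<comment> \<open>The scalar minimizer; where both eigenvalues vanish, any splitting attains the value 0.\<close>
  define X' where "X' = (\<chi> i j. if x $ i + z $ j = 0 then G $ i $ j
    else of_real (z $ j / (x $ i + z $ j)) * G $ i $ j)"
  define Y' where "Y' = (\<chi> i j. if x $ i + z $ j = 0 then 0
    else of_real (x $ i / (x $ i + z $ j)) * G $ i $ j)"
  define X where "X = U ** X' ** ctranspose V"
  define Y where "Y = U ** Y' ** ctranspose V"
  have recover: "ctranspose U ** (U ** M ** ctranspose V) ** V = M" for M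
    by (metis U V matrix_mul_assoc matrix_mul_lid matrix_mul_rid unitary_def)
  have "X' $ i $ j + Y' $ i $ j = G $ i $ j" for i j
  proof (cases "x $ i + z $ j = 0")
    case False
    then have "X' $ i $ j + Y' $ i $ j
        = of_real (z $ j / (x $ i + z $ j) + x $ i / (x $ i + z $ j)) * G $ i $ j"
      by (simp only: X'_def Y'_def vec_lambda_beta if_False of_real_add distrib_right)
    also have "z $ j / (x $ i + z $ j) + x $ i / (x $ i + z $ j) = 1"
      using False by (simp add: add.commute flip: add_divide_distrib)
    finally show ?thesis
      by simp
  qed (simp add: X'_def Y'_def)
  then have "X' + Y' = G"
    by (simp add: vec_eq_iff)
  then have "X + Y = U ** G ** ctranspose V"
    by (simp add: X_def Y_def flip: matrix_add_ldistrib matrix_add_rdistrib)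
  also have "\<dots> = K"
    unfolding G_def by (metis U V matrix_mul_assoc matrix_mul_lid matrix_mul_rid unitary_def)
  finally have "X + Y = K" .
  moreover have "parallel_form U x V z K
      = Re (trace (ctranspose X ** A ** X)) + Re (trace (ctranspose Y ** Y ** Z))"
  proof -
    have "Re (trace (ctranspose X ** A ** X)) = (\<Sum>i\<in>UNIV. \<Sum>j\<in>UNIV.
        (cmod (X' $ i $ j))\<^sup>2 * x $ i)"
      using trace_spec_double_sum[OF assms(1) spec_mat_1[OF V], of X] by (simp add: X_def recover)
    moreover have "Re (trace (ctranspose Y ** Y ** Z)) = (\<Sum>i\<in>UNIV. \<Sum>j\<in>UNIV.
        (cmod (Y' $ i $ j))\<^sup>2 * z $ j)"
      using trace_spec_double_sum[OF spec_mat_1[OF U] assms(2), of Y] by (simp add: Y_def recover)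
    moreover have "(cmod (G $ i $ j))\<^sup>2 * (x $ i * z $ j / (x $ i + z $ j))
        = (cmod (X' $ i $ j))\<^sup>2 * x $ i + (cmod (Y' $ i $ j))\<^sup>2 * z $ j" for i j
    proof (cases "x $ i + z $ j = 0")
      case True
      then have "x $ i = 0"
        using assms(3)[of i] assms(4)[of j] by linarith
      then show ?thesis
        using True by (simp add: X'_def Y'_def)
    next
      case False
      define s where "s = x $ i + z $ j"
      have "(cmod (X' $ i $ j))\<^sup>2 = (cmod (G $ i $ j))\<^sup>2 * (z $ j / s)\<^sup>2"
        "(cmod (Y' $ i $ j))\<^sup>2 = (cmod (G $ i $ j))\<^sup>2 * (x $ i / s)\<^sup>2"
        using False by (simp_all add: X'_def Y'_def norm_mult norm_divide power_mult_distrib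
            power_divide s_def flip: of_real_add)
      moreover have "x $ i * z $ j / s = (z $ j / s)\<^sup>2 * x $ i + (x $ i / s)\<^sup>2 * z $ j"
      proof -
        have "(z $ j / s)\<^sup>2 * x $ i + (x $ i / s)\<^sup>2 * z $ j = (x $ i * z $ j) * s / (s * s)"
          by (simp add: s_def power2_eq_square algebra_simps flip: add_divide_distrib)
        with False show ?thesis
          by (simp add: s_def)
      qed
      ultimately show ?thesis
        by (simp add: s_def algebra_simps)
    qed
    ultimately show ?thesis
      unfolding parallel_form_def G_def[symmetric] by (simp add: sum.distrib)
  qed
  ultimately show thesis
    by (rule that)
qed

text \<open>The parallel sum is the minimum, over the decompositions \<open>X + Y = K\<close>, of an expression that is
  linear in \<open>(A,Z)\<close>.\<close>

lemma parallel_form_concave: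
  assumes "spectral U x A" "spectral V z Z" "spectral U1 x1 A1" "spectral V1 z1 Z1" "spectral U2 x2 A2" "spectral V2 z2 Z2"
    and "\<And>i. 0 \<le> x $ i" "\<And>i. 0 \<le> z $ i" "\<And>i. 0 \<le> x1 $ i" "\<And>i. 0 \<le> z1 $ i"
      "\<And>i. 0 \<le> x2 $ i" "\<And>i. 0 \<le> z2 $ i"
    and A: "A = s *\<^sub>R A1 + t *\<^sub>R A2" and Z: "Z = s *\<^sub>R Z1 + t *\<^sub>R Z2" and "0 \<le> s" "0 \<le> t"
  shows "s * parallel_form U1 x1 V1 z1 K + t * parallel_form U2 x2 V2 z2 K \<le> parallel_form U x V z K"
proof -
  obtain X Y where XY: "X + Y = K" and
    eq: "parallel_form U x V z K = Re (trace (ctranspose X ** A ** X)) + Re (trace (ctranspose Y ** Y ** Z))"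
    using parallel_form_attained[OF assms(1,2,7,8)] by blast
  have "s * parallel_form U1 x1 V1 z1 K + t * parallel_form U2 x2 V2 z2 K
    \<le> s * (Re (trace (ctranspose X ** A1 ** X)) + Re (trace (ctranspose Y ** Y ** Z1)))
      + t * (Re (trace (ctranspose X ** A2 ** X)) + Re (trace (ctranspose Y ** Y ** Z2)))"
    using assms XY by (intro add_mono mult_left_mono) (auto intro: parallel_form_le)
  also have "\<dots> = parallel_form U x V z K"
    unfolding eq A Z
    by (simp add: matrix_add_ldistrib matrix_add_rdistrib matrix_mult_scaleR scaleR_matrix_mult
        Re_trace_add Re_trace_scaleR algebra_simps)
  finally show ?thesis .
qed

lemma integrable_powr_over_1_plus:
  fixes p :: real
  assumes "0 < p" "p < 1"
  shows "(\<lambda>u. u powr (p - 1) / (1 + u)) absolutely_integrable_on {0..}"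
proof -
  have meas: "(\<lambda>u::real. u powr (p - 1) / (1 + u)) \<in> borel_measurable (lebesgue_on S)" for S
    by (intro measurable_restrict_space1 measurable_completion) measurable
  have "(\<lambda>u. u powr (p - 1) / (1 + u)) absolutely_integrable_on {0..1}"
  proof (rule measurable_bounded_by_integrable_imp_absolutely_integrable[OF meas])
    show "(\<lambda>u. u powr (p - 1)) integrable_on {0..1}"
      using assms by (intro integrable_on_powr_from_0) auto
    fix u :: real assume "u \<in> {0..1}"
    then show "norm (u powr (p - 1) / (1 + u)) \<le> u powr (p - 1)"
      by (auto simp: divide_le_eq mult_le_cancel_left1)
  qed auto
  moreover have "(\<lambda>u. u powr (p - 1) / (1 + u)) absolutely_integrable_on {1..}"
  proof (rule measurable_bounded_by_integrable_imp_absolutely_integrable[OF meas])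
    show "(\<lambda>u. u powr (p - 2)) integrable_on {1..}"
      using has_integral_powr_to_inf[of "p - 2" 1] assms by (auto simp: integrable_on_def)
    fix u :: real assume u: "u \<in> {1..}"
    then have "u powr (p - 1) = u powr (p - 2) * u"
      by (simp add: powr_diff powr_mult_base field_simps power2_eq_square)
    with u show "norm (u powr (p - 1) / (1 + u)) \<le> u powr (p - 2)"
      by (auto simp: divide_le_eq)
  qed auto
  ultimately have "(\<lambda>u. u powr (p - 1) / (1 + u)) absolutely_integrable_on ({0..1} \<union> {1..})"
    by (rule set_integrable_Un) auto
  also have "{0..1} \<union> {1..} = {0::real..}"
    by auto
  finally show ?thesis .
qed

text \<open>The substitution \<open>u \<mapsto> u z / x\<close> reduces the integral to the case \<open>x = z = 1\<close>, where
  it is \<open>\<integral> u\<^bsup>p-1\<^esup> / (1 + u) du\<close>. This constant is finite and positive,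
  and its value cancels in the application.\<close>

lemma powr_parallel_sum_integral:
  fixes p :: real
  assumes p: "0 < p" "p < 1"
  shows "\<exists>c>0. \<forall>x z. 0 \<le> x \<longrightarrow> 0 \<le> z \<longrightarrow>
    has_bochner_integral lebesgue
      (\<lambda>u. indicator {0..} u * (u powr (p - 2) * (x * (u * z) / (x + u * z))))
      (c * (x powr p * z powr (1 - p)))"
proof -
  define h where "h = (\<lambda>u::real. indicator {0..} u * (u powr (p - 1) / (1 + u)))"
  define c where "c = integral\<^sup>L lebesgue h"
  have int: "integrable lebesgue h"
    using integrable_powr_over_1_plus[OF p] by (simp add: h_def set_integrable_def)
  then have hc: "has_bochner_integral lebesgue h c"
    by (simp add: c_def has_bochner_integral_integrable)
  have "0 \<le> h u" for u
    by (auto simp: h_def indicator_def)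
  \<comment> \<open>The constant is positive since the integrand does not vanish on \<open>[1,2]\<close>.\<close>
  moreover have "\<not> (AE u in lebesgue. h u = 0)"
  proof
    assume "AE u in lebesgue. h u = 0"
    moreover have sets: "{u. h u \<noteq> 0} \<in> sets lebesgue"
      using borel_measurable_integrable[OF int] by (auto dest: measurable_sets[of _ _ _ "- {0}"] simp: vimage_def)
    ultimately have "emeasure lebesgue {u. h u \<noteq> 0} = 0"
      by (subst (asm) AE_iff_measurable[OF _ refl]) auto
    moreover have "emeasure lebesgue {1..2::real} \<le> emeasure lebesgue {u. h u \<noteq> 0}"
      using sets by (intro emeasure_mono) (auto simp: h_def indicator_def)
    ultimately show False
      by simp
  qed
  ultimately have c: "c > 0"
    using integral_nonneg_eq_0_iff_AE[OF int] integral_nonneg_AE[of h lebesgue]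
    by (force simp: c_def order_less_le)
  show ?thesis
  proof (intro exI[of _ c] conjI allI impI c)
    fix x z :: real assume xz: "0 \<le> x" "0 \<le> z"
    show "has_bochner_integral lebesgue
      (\<lambda>u. indicator {0..} u * (u powr (p - 2) * (x * (u * z) / (x + u * z))))
      (c * (x powr p * z powr (1 - p)))"
    proof (cases "x = 0 \<or> z = 0")
      case True
      then show ?thesis
        by (auto simp: has_bochner_integral_zero)
    next
      case False
      then have pos: "x > 0" "z > 0"
        using xz by auto
      define m where "m = z / x"
      have m: "m > 0"
        using pos by (simp add: m_def)
      have "has_bochner_integral lebesgue (\<lambda>u. h (0 + m * u)) (c /\<^sub>R \<bar>m\<bar>)"
        using has_bochner_integral_lebesgue_real_affine_iff[where c = m and f = h and i = c and t = 0] hc m by simp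
      then have "has_bochner_integral lebesgue (\<lambda>u. h (m * u)) (c / m)"
        using m by (simp add: divide_inverse mult.commute)
      then have "has_bochner_integral lebesgue (\<lambda>u. (z * m powr (1 - p)) * h (m * u))
          ((z * m powr (1 - p)) * (c / m))"
        by (rule has_bochner_integral_mult_right)
      moreover have "(z * m powr (1 - p)) * h (m * u)
          = indicator {0..} u * (u powr (p - 2) * (x * (u * z) / (x + u * z)))" for u
      proof (cases "u > 0")
        case True
        have "(m * u) powr (p - 1) = m powr (p - 1) * u powr (p - 1)"
          using m True by (simp add: powr_mult)
        moreover have "m powr (1 - p) * m powr (p - 1) = 1"
          using m by (simp flip: powr_add)
        ultimately have "(z * m powr (1 - p)) * h (m * u) = z * u powr (p - 1) / (1 + m * u)"
          using m True by (simp add: h_def)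
        moreover have "u powr (p - 1) = u powr (p - 2) * u"
          using True powr_add[of u "p - 2" 1] by simp
        moreover have "1 + m * u = (x + u * z) / x"
          using pos by (simp add: m_def field_simps)
        ultimately show ?thesis
          using True by (simp add: mult_ac)
      next
        case False
        show ?thesis
        proof (cases "u = 0")
          case False
          with \<open>\<not> u > 0\<close> have "u < 0"
            by simp
          then show ?thesis
            using m by (simp add: h_def mult_pos_neg not_le indicator_def)
        qed (simp add: h_def)
      qed
      moreover have "(z * m powr (1 - p)) * (c / m) = c * (x powr p * z powr (1 - p))"
      proof -
        have "z / m = x"
          using pos by (simp add: m_def)
        moreover have "m powr (1 - p) = z powr (1 - p) / x powr (1 - p)"
          using pos by (simp add: m_def powr_divide)
        moreover have "x / x powr (1 - p) = x powr p"
          using pos powr_diff[of x 1 "1 - p"] by simp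
        ultimately show ?thesis
          by (metis (no_types, opaque_lifting) mult.commute mult.left_commute times_divide_eq_left
              times_divide_eq_right)
      qed
      ultimately show ?thesis
        by simp
    qed
  qed
qed

lemma has_bochner_integral_mono:
  fixes f g :: "'a \<Rightarrow> real"
  assumes "has_bochner_integral M f a" "has_bochner_integral M g b" "\<And>x. f x \<le> g x"
  shows "a \<le> b"
  using assms integral_mono[of M f g] by (simp add: has_bochner_integral_iff)

lemma psd_spec:
  assumes "A \<in> psd_cone"
  obtains U d where "spectral U d A" and "\<And>i. 0 \<le> d $ i"
  by (metis assms psd_cone_hermitian spec_psd_nonneg spectral_theorem)

lemma psd_cone_combination:
  assumes "A1 \<in> psd_cone" "A2 \<in> psd_cone" "0 \<le> s" "0 \<le> t" "s + t = 1"
  shows "s *\<^sub>R A1 + t *\<^sub>R A2 \<in> psd_cone"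
  using convexD[OF convex_psd_cone] assms by blast

text \<open>In eigenbases the trace is a nonnegative combination of the numbers \<open>x\<^sub>i\<^sup>p z\<^sub>j\<^bsup>1-p\<^esup>\<close>. The integral
  representation turns it into an integral over \<open>u\<close> of the parallel forms of \<open>A\<close> and \<open>u Z\<close>,
  which are jointly concave.\<close>

theorem lieb_concavity:
  fixes A1 A2 :: "complex^'m^'m" and Z1 Z2 :: "complex^'n^'n" and K :: "complex^'n^'m"
  assumes p: "0 < p" "p < 1"
    and psd: "A1 \<in> psd_cone" "A2 \<in> psd_cone" "Z1 \<in> psd_cone" "Z2 \<in> psd_cone"
    and st: "0 \<le> s" "0 \<le> t" "s + t = 1"
  shows "s * Re (trace (ctranspose K ** psd_power A1 p ** K ** psd_power Z1 (1 - p)))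
      + t * Re (trace (ctranspose K ** psd_power A2 p ** K ** psd_power Z2 (1 - p)))
    \<le> Re (trace (ctranspose K ** psd_power (s *\<^sub>R A1 + t *\<^sub>R A2) p ** K
      ** psd_power (s *\<^sub>R Z1 + t *\<^sub>R Z2) (1 - p)))"
proof -
  define A where "A = s *\<^sub>R A1 + t *\<^sub>R A2"
  define Z where "Z = s *\<^sub>R Z1 + t *\<^sub>R Z2"
  have "A \<in> psd_cone" "Z \<in> psd_cone"
    unfolding A_def Z_def using psd st by (auto intro: psd_cone_combination)
  then obtain U x V z where sp: "spectral U x A" "spectral V z Z"
    and nn: "\<And>i. 0 \<le> x $ i" "\<And>i. 0 \<le> z $ i"
    by (metis psd_spec)
  obtain U1 x1 V1 z1 where sp1: "spectral U1 x1 A1" "spectral V1 z1 Z1"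
    and nn1: "\<And>i. 0 \<le> x1 $ i" "\<And>i. 0 \<le> z1 $ i"
    using psd by (metis psd_spec)
  obtain U2 x2 V2 z2 where sp2: "spectral U2 x2 A2" "spectral V2 z2 Z2"
    and nn2: "\<And>i. 0 \<le> x2 $ i" "\<And>i. 0 \<le> z2 $ i"
    using psd by (metis psd_spec)
  obtain c where c: "c > 0" and int: "\<And>x z. 0 \<le> x \<Longrightarrow> 0 \<le> z \<Longrightarrow>
    has_bochner_integral lebesgue
      (\<lambda>u. indicator {0..} u * (u powr (p - 2) * (x * (u * z) / (x + u * z))))
      (c * (x powr p * z powr (1 - p)))"
    using powr_parallel_sum_integral[OF p] by blast
  let ?f = "\<lambda>U x V z u. indicator {0..} u * (u powr (p - 2) * parallel_form U x V (u *\<^sub>R z) K)"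
  have key: "has_bochner_integral lebesgue (?f U x V z)
      (c * Re (trace (ctranspose K ** psd_power A p ** K ** psd_power Z (1 - p))))"
    if sp: "spectral U x A" "spectral V z Z" and nn: "\<And>i. 0 \<le> x $ i" "\<And>i. 0 \<le> z $ i"
    for U x V z and A :: "complex^'m^'m" and Z :: "complex^'n^'n"
  proof -
    have "has_bochner_integral lebesgue (\<lambda>u. \<Sum>i\<in>UNIV. \<Sum>j\<in>UNIV.
        (cmod ((ctranspose U ** K ** V) $ i $ j))\<^sup>2
          * (indicator {0..} u * (u powr (p - 2) * (x $ i * (u * z $ j) / (x $ i + u * z $ j)))))
      (\<Sum>i\<in>UNIV. \<Sum>j\<in>UNIV. (cmod ((ctranspose U ** K ** V) $ i $ j))\<^sup>2
          * (c * (x $ i powr p * z $ j powr (1 - p))))"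
      by (intro has_bochner_integral_sum has_bochner_integral_mult_right int nn)
    moreover have "(\<Sum>i\<in>UNIV. \<Sum>j\<in>UNIV. (cmod ((ctranspose U ** K ** V) $ i $ j))\<^sup>2
        * (indicator {0..} u * (u powr (p - 2) * (x $ i * (u * z $ j) / (x $ i + u * z $ j)))))
        = ?f U x V z u" for u
      by (simp add: parallel_form_def sum_distrib_left mult_ac)
    moreover have "(\<Sum>i\<in>UNIV. \<Sum>j\<in>UNIV. (cmod ((ctranspose U ** K ** V) $ i $ j))\<^sup>2
          * (c * (x $ i powr p * z $ j powr (1 - p))))
        = c * Re (trace (ctranspose K ** psd_power A p ** K ** psd_power Z (1 - p)))"
      using p by (subst trace_spec_double_sum[OF spec_psd_power[OF sp(1)] spec_psd_power[OF sp(2)]])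
        (simp add: zpowr_def sum_distrib_left mult_ac)
    ultimately show ?thesis
      by simp
  qed
  let ?L = "\<lambda>A Z. Re (trace (ctranspose K ** psd_power A p ** K ** psd_power Z (1 - p)))"
  have "has_bochner_integral lebesgue (\<lambda>u. s * ?f U1 x1 V1 z1 u + t * ?f U2 x2 V2 z2 u)
      (s * (c * ?L A1 Z1) + t * (c * ?L A2 Z2))"
    by (intro has_bochner_integral_add has_bochner_integral_mult_right key sp1 sp2 nn1 nn2)
  moreover have "s * ?f U1 x1 V1 z1 u + t * ?f U2 x2 V2 z2 u \<le> ?f U x V z u" for u
  proof (cases "u \<ge> 0")
    case True
    have "u *\<^sub>R Z = s *\<^sub>R (u *\<^sub>R Z1) + t *\<^sub>R (u *\<^sub>R Z2)"
      by (simp add: Z_def scaleR_add_right mult.commute)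
    then have "s * parallel_form U1 x1 V1 (u *\<^sub>R z1) K + t * parallel_form U2 x2 V2 (u *\<^sub>R z2) K
        \<le> parallel_form U x V (u *\<^sub>R z) K"
      using True nn nn1 nn2 st
      by (intro parallel_form_concave[OF sp(1) spec_scaleR[OF sp(2)] sp1(1) spec_scaleR[OF sp1(2)]
            sp2(1) spec_scaleR[OF sp2(2)] _ _ _ _ _ _ A_def])
         (auto simp: A_def)
    from mult_left_mono[OF this, of "u powr (p - 2)"] show ?thesis
      using True by (simp add: algebra_simps)
  qed simp
  ultimately have "s * (c * ?L A1 Z1) + t * (c * ?L A2 Z2) \<le> c * ?L A Z"
    by (rule has_bochner_integral_mono[OF _ key[OF sp nn]])
  then have "c * (s * ?L A1 Z1 + t * ?L A2 Z2) \<le> c * ?L A Z"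
    by (simp add: algebra_simps)
  with c show ?thesis
    by (simp add: A_def Z_def)
qed

section \<open>Epstein's concavity theorem\<close>

lemma weighted_am_gm:
  fixes x z :: real
  assumes "0 \<le> x" "0 \<le> z" "0 < a" "a < 1"
  shows "x powr a * z powr (1 - a) \<le> a * x + (1 - a) * z"
proof (cases "x = 0 \<or> z = 0")
  case False
  then show ?thesis
    using Youngs_inequality_0[of a "1 - a" x z] assms by simp
qed (use assms in auto)

text \<open>In eigenbases of \<open>X\<close> and \<open>Z\<close> this is the weighted arithmetic-geometric mean inequality,
  averaged over a doubly stochastic matrix.\<close>

lemma trace_young:
  assumes a: "0 < a" "a < 1" and psd: "X \<in> psd_cone" "Z \<in> psd_cone"
  shows "Re (trace (X ** psd_power Z (1 - a))) \<le> a * trace_power X (1 / a) + (1 - a) * Re (trace Z)"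
proof -
  obtain U x V z where sp: "spectral U x X" "spectral V z Z"
    and nn: "\<And>i. 0 \<le> x $ i" "\<And>i. 0 \<le> z $ i"
    using psd by (metis psd_spec)
  have un: "unitary U" "unitary V"
    using sp by (auto simp: spectral_def)
  let ?g = "\<lambda>i j. (cmod ((ctranspose U ** mat 1 ** V) $ i $ j))\<^sup>2"
  have "Re (trace (X ** psd_power Z (1 - a))) = (\<Sum>i\<in>UNIV. \<Sum>j\<in>UNIV. ?g i j * (x $ i * z $ j powr (1 - a)))"
    using trace_spec_double_sum[OF sp(1) spec_psd_power[OF sp(2)], of "mat 1" "1 - a"] a
    by (simp add: zpowr_def)
  also have "\<dots> \<le> (\<Sum>i\<in>UNIV. \<Sum>j\<in>UNIV. ?g i j * (a * x $ i powr (1 / a) + (1 - a) * z $ j))"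
  proof (intro sum_mono mult_left_mono)
    fix i j
    have "x $ i = (x $ i powr (1 / a)) powr a"
      using a nn(1)[of i] by (simp add: powr_powr)
    then show "x $ i * z $ j powr (1 - a) \<le> a * x $ i powr (1 / a) + (1 - a) * z $ j"
      using weighted_am_gm[of "x $ i powr (1 / a)" "z $ j" a] a nn by simp
  qed auto
  also have "\<dots> = a * (\<Sum>i\<in>UNIV. \<Sum>j\<in>UNIV. ?g i j * (zpowr (x $ i) (1 / a) * 1))
      + (1 - a) * (\<Sum>i\<in>UNIV. \<Sum>j\<in>UNIV. ?g i j * (1 * z $ j))"
    using a by (simp add: zpowr_def sum_distrib_left distrib_left sum.distrib mult_ac)
  also have "\<dots> = a * trace_power X (1 / a) + (1 - a) * Re (trace Z)"
    using trace_spec_double_sum[OF spec_psd_power[OF sp(1)] spec_mat_1[OF un(2)], of "mat 1" "1 / a"]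
      trace_spec_double_sum[OF spec_mat_1[OF un(1)] sp(2), of "mat 1"]
    by (simp add: trace_power_def)
  finally show ?thesis .
qed

lemma trace_young_equality:
  assumes a: "0 < a" "a < 1" and psd: "X \<in> psd_cone"
  shows "Re (trace (X ** psd_power (psd_power X (1 / a)) (1 - a))) = trace_power X (1 / a)"
proof -
  obtain U x where sp: "spectral U x X" and nn: "\<And>i. 0 \<le> x $ i"
    using psd by (metis psd_spec)
  have un: "ctranspose U ** U = mat 1" "unitary U"
    using sp by (auto simp: spectral_def unitary_def)
  define Y where "Y = psd_power (psd_power X (1 / a)) (1 - a)"
  have Y: "spectral U (\<chi> i. zpowr (zpowr (x $ i) (1 / a)) (1 - a)) Y"
    unfolding Y_def using spec_psd_power[OF spec_psd_power[OF sp]] by simp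
  have "X ** Y = U ** diag_real x ** (ctranspose U ** U)
      ** diag_real (\<chi> i. zpowr (zpowr (x $ i) (1 / a)) (1 - a)) ** ctranspose U"
    using sp Y by (simp add: spectral_def matrix_mul_assoc)
  also have "\<dots> = U ** (diag_real x ** diag_real (\<chi> i. zpowr (zpowr (x $ i) (1 / a)) (1 - a)))
      ** ctranspose U"
    using un by (simp add: matrix_mul_assoc)
  also have "\<dots> = U ** diag_real (\<chi> i. zpowr (x $ i) (1 / a)) ** ctranspose U"
  proof -
    have "x $ i * zpowr (zpowr (x $ i) (1 / a)) (1 - a) = zpowr (x $ i) (1 / a)" for i
    proof -
      have "x $ i * x $ i powr ((1 - a) / a) = x $ i powr (1 + (1 - a) / a)"
        using nn by (simp add: powr_mult_base)
      also have "1 + (1 - a) / a = 1 / a"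
        using a by (simp add: field_simps)
      finally show ?thesis
        using a by (simp add: zpowr_def powr_powr)
    qed
    then show ?thesis
      by (simp add: diag_real_mult)
  qed
  finally show ?thesis
    using trace_unitary_diag[OF un(2)] trace_power_spec[OF sp] by (simp add: Y_def)
qed

lemma trace_power_1: "X \<in> psd_cone \<Longrightarrow> trace_power X 1 = Re (trace X)"
  by (elim psd_spec) (simp add: trace_power_spec trace_spec zpowr_def)

lemma psd_power_1: "X \<in> psd_cone \<Longrightarrow> psd_power X 1 = X"
proof (elim psd_spec)
  fix U d assume "spectral U d X" and "\<And>i. 0 \<le> d $ i"
  then show "psd_power X 1 = X"
    using spec_psd_power[of U d X 1] by (simp add: spectral_def zpowr_def)
qed

text \<open>Let \<open>X\<^sub>i = K\<^sup>* A\<^sub>i\<^sup>a K\<close>. The choice \<open>Z\<^sub>i = X\<^sub>i\<^bsup>1/a\<^esup>\<close> makes the trace Young inequality an equality at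
  the two end points; Lieb's theorem carries the left sides to the convex combination, where the
  Young inequality is applied once more.\<close>

theorem epstein_concavity:
  fixes A1 A2 :: "complex^'m^'m" and K :: "complex^'n^'m"
  assumes a: "0 < a" "a \<le> 1" and psd: "A1 \<in> psd_cone" "A2 \<in> psd_cone"
    and st: "0 \<le> s" "0 \<le> t" "s + t = 1"
  shows "s * trace_power (ctranspose K ** psd_power A1 a ** K) (1 / a)
      + t * trace_power (ctranspose K ** psd_power A2 a ** K) (1 / a)
    \<le> trace_power (ctranspose K ** psd_power (s *\<^sub>R A1 + t *\<^sub>R A2) a ** K) (1 / a)"
proof -
  define A where "A = s *\<^sub>R A1 + t *\<^sub>R A2"
  have A: "A \<in> psd_cone"
    unfolding A_def using psd st by (auto intro: psd_cone_combination)
  let ?X = "\<lambda>A. ctranspose K ** psd_power A a ** K"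
  have X: "?X A \<in> psd_cone" if "A \<in> psd_cone" for A
    using that by (intro psd_cone_congruence psd_power_psd)
  show ?thesis
  proof (cases "a = 1")
    case True
    with psd A X[OF A] X[OF psd(1)] X[OF psd(2)] show ?thesis
      unfolding A_def[symmetric]
      by (simp add: psd_power_1 trace_power_1)
         (simp add: A_def matrix_add_ldistrib matrix_add_rdistrib matrix_mult_scaleR
           scaleR_matrix_mult Re_trace_add Re_trace_scaleR)
  next
    case False
    with a have a: "0 < a" "a < 1"
      by auto
    define Z1 where "Z1 = psd_power (?X A1) (1 / a)"
    define Z2 where "Z2 = psd_power (?X A2) (1 / a)"
    have Z12: "Z1 \<in> psd_cone" "Z2 \<in> psd_cone"
      by (auto simp: Z1_def Z2_def intro: psd_power_psd X psd)
    define Z where "Z = s *\<^sub>R Z1 + t *\<^sub>R Z2"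
    have Z: "Z \<in> psd_cone"
      unfolding Z_def using Z12 st by (auto intro: psd_cone_combination)
    let ?T = "\<lambda>A. trace_power (?X A) (1 / a)"
    have trZ: "Re (trace Z) = s * ?T A1 + t * ?T A2"
      by (simp add: Z_def Z1_def Z2_def trace_power_def Re_trace_add Re_trace_scaleR)
    have "s * ?T A1 + t * ?T A2
        = s * Re (trace (?X A1 ** psd_power Z1 (1 - a))) + t * Re (trace (?X A2 ** psd_power Z2 (1 - a)))"
      using trace_young_equality[OF a X] psd by (simp add: Z1_def Z2_def)
    also have "\<dots> \<le> Re (trace (?X A ** psd_power Z (1 - a)))"
      unfolding A_def Z_def by (rule lieb_concavity[OF a psd Z12 st])
    also have "\<dots> \<le> a * ?T A + (1 - a) * Re (trace Z)"
      by (rule trace_young[OF a X[OF A] Z])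
    finally have "a * (s * ?T A1 + t * ?T A2) \<le> a * ?T A"
      unfolding trZ by (simp add: algebra_simps)
    with a show ?thesis
      by (simp add: A_def)
  qed
qed

section \<open>Sums of smallest entries and supermajorization\<close>

definition smallest_sum :: "nat \<Rightarrow> real^'n \<Rightarrow> real" where
  "smallest_sum k x = Min ((\<lambda>S. \<Sum>i\<in>S. x $ i) ` {S. card S = k})"

lemma smallest_sum_le: "card S = k \<Longrightarrow> smallest_sum k x \<le> (\<Sum>i\<in>S. x $ i)" for S :: "'n::finite set"
  unfolding smallest_sum_def by (rule Min_le) auto

lemma smallest_sum_attained:
  fixes x :: "real^'n"
  assumes "k \<le> CARD('n)"
  obtains S where "card S = k" and "smallest_sum k x = (\<Sum>i\<in>S. x $ i)"
proof -
  obtain S :: "'n set" where "card S = k"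
    using obtain_subset_with_card_n[OF assms] by auto
  then have "(\<lambda>S. \<Sum>i\<in>S. x $ i) ` {S. card S = k} \<noteq> {}"
    by auto
  then have "smallest_sum k x \<in> (\<lambda>S. \<Sum>i\<in>S. x $ i) ` {S. card S = k}"
    unfolding smallest_sum_def by (intro Min_in) auto
  then show thesis
    using that by auto
qed

text \<open>An enumeration of the coordinates along which \<open>x\<close> increases; it stands in for an order on the
  index type.\<close>

definition sorts :: "(nat \<Rightarrow> 'n) \<Rightarrow> real^'n \<Rightarrow> bool" where
  "sorts \<sigma> x \<longleftrightarrow> bij_betw \<sigma> {..<CARD('n)} UNIV \<and>
    (\<forall>i j. i \<le> j \<longrightarrow> j < CARD('n) \<longrightarrow> x $ \<sigma> i \<le> x $ \<sigma> j)"

lemma sorts_exists: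
  fixes x :: "real^'n"
  obtains \<sigma> where "sorts \<sigma> x"
proof -
  obtain xs :: "'n list" where xs: "set xs = UNIV" "distinct xs"
    using finite_distinct_list[of "UNIV :: 'n set"] by auto
  define ys where "ys = sort_key (\<lambda>i. x $ i) xs"
  have ys: "set ys = UNIV" "distinct ys" "sorted (map (\<lambda>i. x $ i) ys)"
    using xs by (simp_all add: ys_def)
  have len: "length ys = CARD('n)"
    using ys distinct_card by fastforce
  have "bij_betw ((!) ys) {..<CARD('n)} UNIV"
    using bij_betw_nth[OF ys(2), of "{..<CARD('n)}" UNIV] ys len by simp
  moreover have "x $ (ys ! i) \<le> x $ (ys ! j)" if "i \<le> j" "j < CARD('n)" for i j
    using sorted_nth_mono[OF ys(3), of i j] that len by simp
  ultimately have "sorts ((!) ys) x"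
    by (simp add: sorts_def)
  then show thesis
    by (rule that)
qed

text \<open>Used to reorder one vector so that it increases along the enumeration of the other.\<close>

lemma sorts_matching:
  fixes x y :: "real^'n"
  assumes "sorts \<sigma> x" and "sorts \<rho> y"
  obtains \<pi> where "\<pi> permutes UNIV" and "\<And>i. i < CARD('n) \<Longrightarrow> \<pi> (\<sigma> i) = \<rho> i"
proof -
  have b\<sigma>: "bij_betw \<sigma> {..<CARD('n)} UNIV" and b\<rho>: "bij_betw \<rho> {..<CARD('n)} UNIV"
    using assms by (auto simp: sorts_def)
  define \<pi> where "\<pi> = \<rho> \<circ> inv_into {..<CARD('n)} \<sigma>"
  have "bij \<pi>"
    unfolding \<pi>_def using bij_betw_trans[OF bij_betw_inv_into[OF b\<sigma>] b\<rho>] by simp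
  then have "\<pi> permutes UNIV"
    by (intro bij_imp_permutes) auto
  moreover have "\<pi> (\<sigma> i) = \<rho> i" if "i < CARD('n)" for i
    using that b\<sigma> by (simp add: \<pi>_def bij_betw_inv_into_left)
  ultimately show thesis
    by (rule that)
qed

lemma sum_initial_segment_le:
  fixes y :: "nat \<Rightarrow> real"
  assumes mono: "\<And>i j. i \<le> j \<Longrightarrow> j < n \<Longrightarrow> y i \<le> y j"
    and T: "T \<subseteq> {..<n}" "card T = k"
  shows "(\<Sum>i<k. y i) \<le> (\<Sum>i\<in>T. y i)"
proof (cases k)
  case (Suc m)
  have fin: "finite T"
    using T finite_subset by blast
  have kn: "k \<le> n"
    using card_mono[OF _ T(1)] T(2) by simp
  have cards: "card ({..<k} - T) = card (T - {..<k})"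
    using card_Diff_subset_Int[of "{..<k}" T] card_Diff_subset_Int[of T "{..<k}"] fin T
    by (simp add: Int_commute)
  have "(\<Sum>i\<in>{..<k} - T. y i) \<le> of_nat (card ({..<k} - T)) * y m"
    using Suc kn by (intro sum_bounded_above mono) auto
  also have "\<dots> \<le> (\<Sum>i\<in>T - {..<k}. y i)"
    unfolding cards using Suc T by (intro sum_bounded_below mono) auto
  finally have "(\<Sum>i\<in>{..<k} - T. y i) + (\<Sum>i\<in>{..<k} \<inter> T. y i)
      \<le> (\<Sum>i\<in>T - {..<k}. y i) + (\<Sum>i\<in>T \<inter> {..<k}. y i)"
    by (simp add: Int_commute)
  moreover have "(\<Sum>i\<in>{..<k} - T. y i) + (\<Sum>i\<in>{..<k} \<inter> T. y i) = (\<Sum>i<k. y i)"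
    by (subst sum.Int_Diff[of "{..<k}" y T]) auto
  moreover have "(\<Sum>i\<in>T - {..<k}. y i) + (\<Sum>i\<in>T \<inter> {..<k}. y i) = (\<Sum>i\<in>T. y i)"
    using fin by (subst sum.Int_Diff[of T y "{..<k}"]) auto
  ultimately show ?thesis
    by simp
qed (use T finite_subset[OF T(1)] in auto)

lemma smallest_sum_sorted:
  fixes x :: "real^'n"
  assumes \<sigma>: "sorts \<sigma> x" and k: "k \<le> CARD('n)"
  shows "smallest_sum k x = (\<Sum>i<k. x $ \<sigma> i)"
proof (rule antisym)
  have inj: "inj_on \<sigma> {..<CARD('n)}" and img: "\<sigma> ` {..<CARD('n)} = UNIV"
    using \<sigma> by (auto simp: sorts_def bij_betw_def)
  have injk: "inj_on \<sigma> {..<k}"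
    using k by (intro inj_on_subset[OF inj]) auto
  have "smallest_sum k x \<le> (\<Sum>i\<in>\<sigma> ` {..<k}. x $ i)"
    by (rule smallest_sum_le) (simp add: card_image[OF injk])
  also have "\<dots> = (\<Sum>i<k. x $ \<sigma> i)"
    by (simp add: sum.reindex[OF injk])
  finally show "smallest_sum k x \<le> (\<Sum>i<k. x $ \<sigma> i)" .
  obtain S where S: "card S = k" "smallest_sum k x = (\<Sum>i\<in>S. x $ i)"
    using smallest_sum_attained[OF k] by blast
  obtain T where T: "T \<subseteq> {..<CARD('n)}" "S = \<sigma> ` T"
    using img by (metis subset_UNIV subset_imageE)
  have injT: "inj_on \<sigma> T"
    by (rule inj_on_subset[OF inj T(1)])
  have "(\<Sum>i<k. x $ \<sigma> i) \<le> (\<Sum>i\<in>T. x $ \<sigma> i)"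
    using \<sigma> S T card_image[OF injT]
    by (intro sum_initial_segment_le[where n = "CARD('n)"]) (auto simp: sorts_def)
  also have "\<dots> = (\<Sum>i\<in>S. x $ i)"
    by (simp add: T(2) sum.reindex[OF injT])
  finally show "(\<Sum>i<k. x $ \<sigma> i) \<le> smallest_sum k x"
    by (simp add: S)
qed

lemma smallest_sum_permute:
  fixes x :: "real^'n"
  assumes "\<pi> permutes UNIV"
  shows "smallest_sum k (\<chi> i. x $ \<pi> i) = smallest_sum k x"
proof -
  have b: "bij \<pi>"
    using assms by (simp add: permutes_bij)
  then have inj: "inj_on \<pi> S" for S
    using bij_is_inj inj_on_subset by blast
  have "(\<lambda>S. \<Sum>i\<in>S. (\<chi> i. x $ \<pi> i) $ i) ` {S. card S = k}
      = (\<lambda>S. \<Sum>i\<in>S. x $ i) ` (\<lambda>S. \<pi> ` S) ` {S. card S = k}"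
    unfolding image_image by (simp add: sum.reindex[OF inj])
  also have "(\<lambda>S. \<pi> ` S) ` {S. card S = k} = {S. card S = k}"
  proof -
    have "S = \<pi> ` (inv \<pi> ` S)" "card (inv \<pi> ` S) = card S" for S
      using b by (auto simp: image_image bij_is_surj surj_f_inv_f card_image bij_imp_bij_inv
          bij_is_inj inj_on_subset[OF bij_is_inj])
    then show ?thesis
      by (auto simp: card_image[OF inj]) (metis (mono_tags, lifting) image_eqI mem_Collect_eq)
  qed
  finally show ?thesis
    by (simp add: smallest_sum_def)
qed

text \<open>Summation by parts, as an induction.\<close>

lemma abel_weighted_sum_ge:
  fixes a d :: "nat \<Rightarrow> real"
  assumes "\<And>i j. i \<le> j \<Longrightarrow> j \<le> n \<Longrightarrow> a j \<le> a i"
    and "\<And>k. k \<le> Suc n \<Longrightarrow> 0 \<le> (\<Sum>i<k. d i)"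
  shows "a n * (\<Sum>i<Suc n. d i) \<le> (\<Sum>i<Suc n. a i * d i)"
  using assms
proof (induction n)
  case (Suc n)
  have "a (Suc n) * (\<Sum>i<Suc n. d i) \<le> a n * (\<Sum>i<Suc n. d i)"
    using Suc.prems(1)[of n "Suc n"] Suc.prems(2)[of "Suc n"] by (intro mult_right_mono) auto
  also have "\<dots> \<le> (\<Sum>i<Suc n. a i * d i)"
    using Suc.prems by (intro Suc.IH) auto
  finally show ?case
    by (simp add: algebra_simps)
qed simp

text \<open>Otherwise \<open>x\<close> is strictly separated from the closed convex set of all vectors that dominate a
  point of the permutation polytope of \<open>w\<close>. The separating functional \<open>a\<close> has nonnegative
  entries. Pairing its largest entries with the smallest ones of \<open>w\<close>, summation by parts shows
  that a permutation of \<open>w\<close> has a pairing with \<open>a\<close> no larger than that of \<open>x\<close>.\<close>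

lemma supermajorization_decomposition:
  fixes x w :: "real^'n"
  assumes le: "\<And>k. k \<le> CARD('n) \<Longrightarrow> smallest_sum k w \<le> smallest_sum k x"
  shows "\<exists>c \<in> convex hull {\<chi> i. w $ \<pi> i | \<pi>. \<pi> permutes UNIV}. c \<le> x"
proof -
  define P where "P = {(\<chi> i. w $ \<pi> i) | \<pi>. \<pi> permutes UNIV}"
  define C where "C = (\<Union>c\<in>convex hull P. \<Union>y\<in>nonneg_orthant. {c + y})"
  have orth: "closed (nonneg_orthant :: (real^'n) set)" "convex (nonneg_orthant :: (real^'n) set)"
    by (auto simp: nonneg_orthant_def convex_def intro!: closed_Collect_all closed_Collect_le
        continuous_intros add_nonneg_nonneg)
  have "P = (\<lambda>\<pi>. \<chi> i. w $ \<pi> i) ` {\<pi>. \<pi> permutes UNIV}"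
    by (auto simp: P_def)
  then have "finite P"
    by (simp add: finite_permutations)
  then have "compact (convex hull P)"
    by (intro compact_convex_hull finite_imp_compact)
  then have "closed C" "convex C"
    unfolding C_def using orth by (auto intro: compact_closed_sums convex_sums)
  have "x \<in> C"
  proof (rule ccontr)
    assume "x \<notin> C"
    then obtain a b where ab: "a \<bullet> x < b" "\<And>c. c \<in> C \<Longrightarrow> b < a \<bullet> c"
      using separating_hyperplane_closed_point[OF \<open>convex C\<close> \<open>closed C\<close>] by blast
    have PC: "c + y \<in> C" if "c \<in> P" "y \<in> nonneg_orthant" for c y
      using that hull_subset[of P convex] by (auto simp: C_def)
    have "w \<in> P"
      unfolding P_def by (rule CollectI, rule exI[of _ id]) (simp add: permutes_id)
    have a: "0 \<le> a $ i" for i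
    proof (rule ccontr)
      assume neg: "\<not> 0 \<le> a $ i"
      \<comment> \<open>Moving along a coordinate with a negative entry would push the functional below \<open>b\<close>.\<close>
      define t where "t = \<bar>(b - a \<bullet> w) / a $ i\<bar>"
      have "w + t *\<^sub>R axis i 1 \<in> C"
        by (rule PC[OF \<open>w \<in> P\<close>]) (auto simp: nonneg_orthant_def t_def axis_def)
      from ab(2)[OF this] have "b - a \<bullet> w < t * a $ i"
        by (simp add: inner_add_right inner_axis)
      moreover have "t * a $ i = - \<bar>b - a \<bullet> w\<bar>"
        using neg by (simp add: t_def abs_divide)
      ultimately show False
        by linarith
    qed
    obtain \<sigma> where \<sigma>: "sorts \<sigma> (- a)"
      using sorts_exists by blast
    obtain \<rho> where \<rho>: "sorts \<rho> w"
      using sorts_exists by blast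
    have b\<sigma>: "bij_betw \<sigma> {..<CARD('n)} UNIV" and b\<rho>: "bij_betw \<rho> {..<CARD('n)} UNIV"
      using \<sigma> \<rho> by (auto simp: sorts_def)
    obtain \<pi> where perm: "\<pi> permutes UNIV" and \<pi>\<sigma>: "\<And>i. i < CARD('n) \<Longrightarrow> \<pi> (\<sigma> i) = \<rho> i"
      using sorts_matching[OF \<sigma> \<rho>] by blast
    have reindex: "(\<Sum>i\<in>UNIV. f i) = (\<Sum>i<CARD('n). f (\<sigma> i))" for f :: "'n \<Rightarrow> real"
      using sum.reindex_bij_betw[OF b\<sigma>, of f] by simp
    obtain m where m: "CARD('n) = Suc m"
      using gr0_implies_Suc[OF zero_less_card_finite[where 'a = 'n]] by blast
    have pre: "0 \<le> (\<Sum>i<k. x $ \<sigma> i - w $ \<rho> i)" if k: "k \<le> CARD('n)" for k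
    proof -
      have inj: "inj_on \<sigma> {..<k}"
        using b\<sigma> k by (auto simp: bij_betw_def intro: inj_on_subset)
      have "(\<Sum>i<k. w $ \<rho> i) \<le> smallest_sum k x"
        using le[OF k] smallest_sum_sorted[OF \<rho> k] by simp
      also have "\<dots> \<le> (\<Sum>i\<in>\<sigma> ` {..<k}. x $ i)"
        by (rule smallest_sum_le) (simp add: card_image[OF inj])
      also have "\<dots> = (\<Sum>i<k. x $ \<sigma> i)"
        by (simp add: sum.reindex[OF inj])
      finally show ?thesis
        by (simp add: sum_subtractf)
    qed
    have "0 \<le> a $ \<sigma> m * (\<Sum>i<Suc m. x $ \<sigma> i - w $ \<rho> i)"
      using a pre[of "Suc m"] m by (intro mult_nonneg_nonneg) auto
    also have "\<dots> \<le> (\<Sum>i<Suc m. a $ \<sigma> i * (x $ \<sigma> i - w $ \<rho> i))"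
      using \<sigma> pre m by (intro abel_weighted_sum_ge) (auto simp: sorts_def)
    also have "\<dots> = a \<bullet> x - a \<bullet> (\<chi> i. w $ \<pi> i)"
      unfolding inner_vec_def reindex m
      by (simp add: right_diff_distrib sum_subtractf \<pi>\<sigma> m)
    finally have "a \<bullet> (\<chi> i. w $ \<pi> i) \<le> a \<bullet> x"
      by simp
    moreover have "(\<chi> i. w $ \<pi> i) \<in> P"
      using perm by (auto simp: P_def)
    then have "b < a \<bullet> (\<chi> i. w $ \<pi> i)"
      using PC[of _ 0] ab(2) by (simp add: nonneg_orthant_def)
    ultimately show False
      using ab(1) by simp
  qed
  then obtain c y where "c \<in> convex hull P" "y \<in> nonneg_orthant" "x = c + y"
    by (auto simp: C_def)
  then show ?thesis
    unfolding P_def[symmetric] by (intro bexI[of _ c]) (auto simp: less_eq_vec_def nonneg_orthant_def)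
qed

lemma symmetric_concave_supermajorization:
  fixes \<phi> :: "real^'n \<Rightarrow> real"
  assumes sym: "symmetric_form \<phi>" and mono: "mono_on nonneg_orthant \<phi>"
    and conc: "concave_on nonneg_orthant \<phi>"
    and x: "x \<in> nonneg_orthant" and w: "w \<in> nonneg_orthant"
    and le: "\<And>k. k \<le> CARD('n) \<Longrightarrow> smallest_sum k w \<le> smallest_sum k x"
  shows "\<phi> w \<le> \<phi> x"
proof -
  \<comment> \<open>A convex superlevel set that contains the permutations of \<open>w\<close>, hence their convex hull.\<close>
  define L where "L = {y \<in> nonneg_orthant. \<phi> w \<le> \<phi> y}"
  have "convex L"
    unfolding convex_def
  proof (intro ballI allI impI)
    fix y z and u v :: real
    assume yz: "y \<in> L" "z \<in> L" and uv: "0 \<le> u" "0 \<le> v" "u + v = 1"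
    have "\<phi> w = u * \<phi> w + v * \<phi> w"
      using uv by (simp flip: distrib_right)
    also have "\<dots> \<le> u * \<phi> y + v * \<phi> z"
      using yz uv by (intro add_mono mult_left_mono) (auto simp: L_def)
    also have "\<dots> \<le> \<phi> (u *\<^sub>R y + v *\<^sub>R z)"
      using conc yz uv by (auto simp: concave_on_iff L_def)
    finally show "u *\<^sub>R y + v *\<^sub>R z \<in> L"
      using yz uv conc convexD[of nonneg_orthant y z u v] by (auto simp: L_def concave_on_iff)
  qed
  moreover have "{\<chi> i. w $ \<pi> i | \<pi>. \<pi> permutes UNIV} \<subseteq> L"
    using sym w by (auto simp: L_def symmetric_form_def nonneg_orthant_def)
  ultimately have "convex hull {\<chi> i. w $ \<pi> i | \<pi>. \<pi> permutes UNIV} \<subseteq> L"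
    by (rule hull_minimal[rotated])
  then obtain c where "c \<in> L" "c \<le> x"
    using supermajorization_decomposition[OF le] by blast
  then show ?thesis
    using mono_onD[OF mono, of c x] x by (auto simp: L_def)
qed

text \<open>Permuting \<open>z\<close> so that it is sorted like \<open>y\<close> makes the sums of smallest entries additive on the
  combination \<open>w = s y + t z'\<close>. Then \<open>x\<close> is compared with \<open>w\<close>, and \<open>w\<close> with its ingredients by
  concavity.\<close>

theorem symmetric_concave_of_smallest_sum_concave:
  fixes \<phi> :: "real^'n \<Rightarrow> real"
  assumes sym: "symmetric_form \<phi>" and mono: "mono_on nonneg_orthant \<phi>"
    and conc: "concave_on nonneg_orthant \<phi>"
    and x: "x \<in> nonneg_orthant" and y: "y \<in> nonneg_orthant" and z: "z \<in> nonneg_orthant"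
    and st: "0 \<le> s" "0 \<le> t" "s + t = 1"
    and le: "\<And>k. k \<le> CARD('n) \<Longrightarrow> s * smallest_sum k y + t * smallest_sum k z \<le> smallest_sum k x"
  shows "s * \<phi> y + t * \<phi> z \<le> \<phi> x"
proof -
  obtain \<sigma> where \<sigma>: "sorts \<sigma> y"
    using sorts_exists by blast
  obtain \<rho> where \<rho>: "sorts \<rho> z"
    using sorts_exists by blast
  have b\<sigma>: "bij_betw \<sigma> {..<CARD('n)} UNIV" and b\<rho>: "bij_betw \<rho> {..<CARD('n)} UNIV"
    using \<sigma> \<rho> by (auto simp: sorts_def)
  obtain \<pi> where perm: "\<pi> permutes UNIV" and \<pi>\<sigma>: "\<And>i. i < CARD('n) \<Longrightarrow> \<pi> (\<sigma> i) = \<rho> i"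
    using sorts_matching[OF \<sigma> \<rho>] by blast
  define z' where "z' = (\<chi> i. z $ \<pi> i)"
  have z': "z' \<in> nonneg_orthant"
    using z by (simp add: z'_def nonneg_orthant_def)
  define w where "w = s *\<^sub>R y + t *\<^sub>R z'"
  have w: "w \<in> nonneg_orthant"
    using y z' st by (simp add: w_def nonneg_orthant_def)
  have w\<sigma>: "w $ \<sigma> i = s * y $ \<sigma> i + t * z $ \<rho> i" if "i < CARD('n)" for i
    using that by (simp add: w_def z'_def \<pi>\<sigma>)
  have sw: "sorts \<sigma> w"
    unfolding sorts_def
  proof (intro conjI allI impI b\<sigma>)
    fix i j assume "i \<le> j" "j < CARD('n)"
    then show "w $ \<sigma> i \<le> w $ \<sigma> j"
      using \<sigma> \<rho> st by (simp add: w\<sigma> sorts_def add_mono mult_left_mono)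
  qed
  have "smallest_sum k w = s * smallest_sum k y + t * smallest_sum k z" if "k \<le> CARD('n)" for k
    using that
    by (simp add: smallest_sum_sorted[OF sw] smallest_sum_sorted[OF \<sigma>] smallest_sum_sorted[OF \<rho>] w\<sigma> sum.distrib
        flip: sum_distrib_left)
  then have "\<phi> w \<le> \<phi> x"
    using le by (intro symmetric_concave_supermajorization[OF sym mono conc x w]) simp
  moreover have "s * \<phi> y + t * \<phi> z' \<le> \<phi> w"
    using conc y z' st by (simp add: w_def concave_on_iff)
  moreover have "\<phi> z' = \<phi> z"
    using sym z perm by (simp add: z'_def symmetric_form_def)
  ultimately show ?thesis
    by simp
qed

section \<open>The Peierls inequality and a trace Hoelder inequality\<close>

lemma spec_quadratic_form:
  assumes "spectral U d A"
  shows "x \<bullet> (A *v x) = (\<Sum>i\<in>UNIV. d $ i * (cmod ((ctranspose U *v x) $ i))\<^sup>2)"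
proof -
  define y where "y = ctranspose U *v x"
  have "A *v x = U *v (diag_real d *v y)"
    using assms by (simp add: spectral_def y_def matrix_vector_mul_assoc matrix_mul_assoc)
  then have "cinner x (A *v x) = cinner y (diag_real d *v y)"
    by (simp add: cinner_adjoint[of x U] y_def)
  then have "x \<bullet> (A *v x) = y \<bullet> (diag_real d *v y)"
    by (simp flip: Re_cinner)
  also have "\<dots> = (\<Sum>i\<in>UNIV. d $ i * (y $ i \<bullet> y $ i))"
    by (simp add: inner_vec_def matrix_vector_mult_def diag_real_def if_distrib[of "\<lambda>x. x * _"]
        cong: if_cong) (simp flip: scaleR_conv_of_real)
  finally show ?thesis
    by (simp add: y_def power2_norm_eq_inner)
qed

lemma unitary_norm:
  assumes "unitary U"
  shows "x \<bullet> x = (\<Sum>i\<in>UNIV. (cmod ((ctranspose U *v x) $ i))\<^sup>2)"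
  using spec_quadratic_form[OF spec_mat_1[OF assms], of x] by simp

lemma ctranspose_mult_nth: "(ctranspose X ** Y) $ i $ j = cinner (column i X) (column j Y)"
  by (simp add: matrix_matrix_mult_def cinner_def column_def)

lemma gram_diag_nth: "(ctranspose X ** X) $ i $ i = of_real (\<Sum>k\<in>UNIV. (cmod (X $ k $ i))\<^sup>2)"
  by (simp add: matrix_mult_nth mult.commute flip: complex_norm_square)

definition diag_indicator :: "'n set \<Rightarrow> complex^'n^'n" where
  "diag_indicator S = diag_real (\<chi> i. if i \<in> S then 1 else 0)"

lemma ctranspose_diag_indicator [simp]: "ctranspose (diag_indicator S) = diag_indicator S"
  by (simp add: diag_indicator_def)

text \<open>The convex function \<open>x\<^sup>c\<close> lies above its tangent at \<open>m\<close>, multiplied out so that \<open>m = 0\<close> and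
  \<open>c = 1\<close> are included.\<close>

lemma powr_tangent_le:
  fixes x m c :: real
  assumes "0 \<le> x" "0 \<le> m" "1 \<le> c"
  shows "c * (x * m powr (c - 1)) \<le> x powr c + (c - 1) * m powr c"
proof (cases "c = 1")
  case False
  with assms have c: "c > 1"
    by simp
  have "(x powr c) powr (1 / c) = x" "(m powr c) powr (1 - 1 / c) = m powr (c - 1)"
    using assms c by (simp_all add: powr_powr right_diff_distrib)
  then have "x * m powr (c - 1) \<le> (1 / c) * x powr c + (1 - 1 / c) * m powr c"
    using weighted_am_gm[of "x powr c" "m powr c" "1 / c"] c by simp
  then have "c * (x * m powr (c - 1)) \<le> c * ((1 / c) * x powr c + (1 - 1 / c) * m powr c)"
    using c by (intro mult_left_mono) auto
  also have "\<dots> = x powr c + (c - 1) * m powr c"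
    using c by (simp add: field_simps)
  finally show ?thesis .
qed (use assms in \<open>auto simp: zero_less_iff_neq_zero\<close>)

lemma powr_jensen:
  fixes g x :: "'a \<Rightarrow> real"
  assumes "finite J" and g: "\<And>j. j \<in> J \<Longrightarrow> 0 \<le> g j" "(\<Sum>j\<in>J. g j) \<le> 1"
    and x: "\<And>j. j \<in> J \<Longrightarrow> 0 \<le> x j" and c: "1 \<le> c"
  shows "(\<Sum>j\<in>J. g j * x j) powr c \<le> (\<Sum>j\<in>J. g j * x j powr c)"
proof -
  define m where "m = (\<Sum>j\<in>J. g j * x j)"
  have m: "0 \<le> m"
    unfolding m_def using g x by (intro sum_nonneg) auto
  have "c * m powr c = c * (m * m powr (c - 1))"
    using m powr_mult_base[of m "c - 1"] by simp
  also have "\<dots> = (\<Sum>j\<in>J. g j * (c * (x j * m powr (c - 1))))"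
    by (simp add: m_def sum_distrib_left sum_distrib_right mult_ac)
  also have "\<dots> \<le> (\<Sum>j\<in>J. g j * (x j powr c + (c - 1) * m powr c))"
    using g x m c by (intro sum_mono mult_left_mono powr_tangent_le) auto
  also have "\<dots> = (\<Sum>j\<in>J. g j * x j powr c) + (\<Sum>j\<in>J. g j) * ((c - 1) * m powr c)"
    by (simp add: distrib_left sum.distrib sum_distrib_right)
  also have "\<dots> \<le> (\<Sum>j\<in>J. g j * x j powr c) + 1 * ((c - 1) * m powr c)"
    using g c by (intro add_left_mono mult_right_mono) auto
  finally show ?thesis
    by (simp add: m_def algebra_simps)
qed

text \<open>Bessel's inequality: \<open>P = T T\<^sup>*\<close> is an orthogonal projection, so its diagonal entries satisfy
  \<open>\<rho>\<^sup>2 \<le> \<rho>\<close>.\<close>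

lemma partial_isometry_row_sum_le_1:
  fixes T :: "complex^'n^'m"
  assumes "ctranspose T ** T = diag_indicator I"
  shows "(\<Sum>i\<in>UNIV. (cmod (T $ j $ i))\<^sup>2) \<le> 1"
proof -
  have col: "(\<Sum>k\<in>UNIV. (cmod (T $ k $ i))\<^sup>2) = 0" if "i \<notin> I" for i
  proof -
    have "(ctranspose T ** T) $ i $ i = 0"
      using that by (simp add: assms diag_indicator_def diag_real_def)
    then show ?thesis
      unfolding gram_diag_nth using of_real_eq_0_iff by blast
  qed
  have "T $ k $ i = 0" if "i \<notin> I" for i k
    using col[OF that] by (simp add: sum_nonneg_eq_0_iff)
  then have "T ** diag_indicator I = T"
    by (auto simp: vec_eq_iff diag_indicator_def mult_diag_real_nth)
  define P where "P = T ** ctranspose T"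
  have "P ** P = T ** (ctranspose T ** T) ** ctranspose T"
    by (simp add: P_def matrix_mul_assoc)
  also have "\<dots> = P"
    by (simp add: assms \<open>T ** diag_indicator I = T\<close> P_def)
  finally have PP: "P ** P = P" .
  have "ctranspose P = P"
    by (simp add: P_def ctranspose_mult)
  define \<rho> where "\<rho> = (\<Sum>i\<in>UNIV. (cmod (T $ j $ i))\<^sup>2)"
  have \<rho>: "P $ j $ j = of_real \<rho>"
    using gram_diag_nth[of "ctranspose T" j] by (simp add: P_def \<rho>_def)
  have "P $ j $ j = of_real (\<Sum>k\<in>UNIV. (cmod (P $ k $ j))\<^sup>2)"
    using gram_diag_nth[of P j] PP \<open>ctranspose P = P\<close> by simp
  then have "\<rho> = (\<Sum>k\<in>UNIV. (cmod (P $ k $ j))\<^sup>2)"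
    unfolding \<rho> of_real_eq_iff .
  also have "\<dots> \<ge> (cmod (P $ j $ j))\<^sup>2"
    by (rule member_le_sum) auto
  finally have "\<rho>\<^sup>2 \<le> \<rho>"
    by (simp add: \<rho>)
  then show ?thesis
    unfolding \<rho>_def[symmetric] by (metis linorder_not_less mult_less_cancel_left_pos mult.right_neutral
        power2_eq_square less_trans zero_less_one)
qed

text \<open>The diagonal entries of \<open>M\<^sup>* X M\<close> are averages of the eigenvalues of \<open>X\<close> with doubly
  substochastic weights; Jensen's inequality applies because \<open>t \<mapsto> t\<^sup>c\<close> is convex.\<close>

lemma peierls:
  fixes X M :: "complex^'n^'n"
  assumes X: "X \<in> psd_cone" and c: "1 \<le> c" and M: "ctranspose M ** M = diag_indicator I"
  shows "(\<Sum>i\<in>UNIV. Re ((ctranspose M ** X ** M) $ i $ i) powr c) \<le> trace_power X c"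
proof -
  obtain V x where sp: "spectral V x X" and x: "\<And>j. 0 \<le> x $ j"
    using psd_spec[OF X] by metis
  have V: "V ** ctranspose V = mat 1"
    using sp by (simp add: spectral_def unitary_def)
  define T where "T = ctranspose V ** M"
  have "ctranspose T ** T = ctranspose M ** (V ** ctranspose V) ** M"
    by (simp add: T_def ctranspose_mult matrix_mul_assoc)
  then have T: "ctranspose T ** T = diag_indicator I"
    by (simp add: V M)
  let ?g = "\<lambda>j i. (cmod (T $ j $ i))\<^sup>2"
  have col: "(\<Sum>j\<in>UNIV. ?g j i) \<le> 1" for i
  proof -
    have "complex_of_real (\<Sum>j\<in>UNIV. ?g j i) = of_real (if i \<in> I then 1 else 0)"
      using gram_diag_nth[of T i] by (simp add: T diag_indicator_def diag_real_def)
    then show ?thesis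
      unfolding of_real_eq_iff by simp
  qed
  have diag: "Re ((ctranspose M ** X ** M) $ i $ i) = (\<Sum>j\<in>UNIV. ?g j i * x $ j)" for i
  proof -
    have "ctranspose M ** X ** M = ctranspose T ** (diag_real x ** T)"
      using sp by (simp add: T_def ctranspose_mult matrix_mul_assoc spectral_def)
    then show ?thesis
      unfolding cmod_power2
      by (simp add: matrix_mult_nth[of "ctranspose T"] diag_real_mult_nth algebra_simps power2_eq_square)
  qed
  have "(\<Sum>i\<in>UNIV. Re ((ctranspose M ** X ** M) $ i $ i) powr c)
      \<le> (\<Sum>i\<in>UNIV. \<Sum>j\<in>UNIV. ?g j i * x $ j powr c)"
    unfolding diag using col x c by (intro sum_mono powr_jensen) auto
  also have "\<dots> = (\<Sum>j\<in>UNIV. (\<Sum>i\<in>UNIV. ?g j i) * x $ j powr c)"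
    by (subst sum.swap) (simp add: sum_distrib_right)
  also have "\<dots> \<le> (\<Sum>j\<in>UNIV. 1 * x $ j powr c)"
    by (intro sum_mono mult_right_mono partial_isometry_row_sum_le_1[OF T]) auto
  also have "\<dots> = trace_power X c"
    using c by (simp add: trace_power_spec[OF sp] zpowr_def)
  finally show ?thesis .
qed

lemma mat_1_psd: "mat 1 \<in> psd_cone"
  by (simp add: psd_cone_iff hermitian_def)

lemma gram_psd: "ctranspose Y ** Y \<in> psd_cone" for Y :: "complex^'n^'m"
  using psd_cone_congruence[OF mat_1_psd, of Y] by simp

text \<open>Orthogonal columns are normalized; columns of length zero stay zero because division by zero
  gives zero.\<close>

lemma normalize_columns:
  assumes L: "ctranspose L ** L = diag_real \<Gamma>" and "\<And>i. 0 \<le> \<Gamma> $ i"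
  shows "ctranspose (L ** diag_real (\<chi> i. 1 / sqrt (\<Gamma> $ i)))
    ** (L ** diag_real (\<chi> i. 1 / sqrt (\<Gamma> $ i))) = diag_indicator {i. 0 < \<Gamma> $ i}"
proof -
  let ?D = "diag_real (\<chi> i. 1 / sqrt (\<Gamma> $ i))"
  have "ctranspose (L ** ?D) ** (L ** ?D) = ?D ** (ctranspose L ** L) ** ?D"
    by (simp add: ctranspose_mult matrix_mul_assoc)
  also have "\<dots> = diag_real (\<chi> i. 1 / sqrt (\<Gamma> $ i) * \<Gamma> $ i * (1 / sqrt (\<Gamma> $ i)))"
    by (simp add: L diag_real_mult)
  also have "\<dots> = diag_indicator {i. 0 < \<Gamma> $ i}"
  proof -
    have "1 / sqrt (\<Gamma> $ i) * \<Gamma> $ i * (1 / sqrt (\<Gamma> $ i)) = (if 0 < \<Gamma> $ i then 1 else 0)" for i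
      using assms(2)[of i] by (simp add: order_less_le)
    then show ?thesis
      by (simp add: diag_indicator_def)
  qed
  finally show ?thesis .
qed

text \<open>The normalized images under \<open>Y\<close> of the eigenvectors of \<open>Y\<^sup>* Y\<close> are orthonormal, and in them the
  diagonal of \<open>Y Y\<^sup>*\<close> consists of the same eigenvalues. The Peierls inequality then compares
  the traces; exchanging \<open>Y\<close> and \<open>Y\<^sup>*\<close> would give equality.\<close>

lemma trace_power_gram_commute_le:
  fixes Y :: "complex^'n^'n"
  assumes c: "1 \<le> c"
  shows "trace_power (ctranspose Y ** Y) c \<le> trace_power (Y ** ctranspose Y) c"
proof -
  define X where "X = ctranspose Y ** Y"
  have "X \<in> psd_cone"
    unfolding X_def by (rule gram_psd)
  then obtain V b where sp: "spectral V b X" and b: "\<And>i. 0 \<le> b $ i"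
    using psd_spec by metis
  let ?D = "diag_real (\<chi> i. 1 / sqrt (b $ i))"
  define L where "L = Y ** V"
  have V: "V ** ctranspose V = mat 1"
    using sp by (simp add: spectral_def unitary_def)
  have "ctranspose L ** L = ctranspose V ** X ** V"
    by (simp add: L_def X_def ctranspose_mult matrix_mul_assoc)
  then have L: "ctranspose L ** L = diag_real b"
    by (simp add: spec_diag[OF sp])
  have "ctranspose L ** (Y ** ctranspose Y) ** L = ctranspose V ** X ** (V ** ctranspose V) ** X ** V"
    by (simp add: V L_def X_def ctranspose_mult matrix_mul_assoc)
  also have "\<dots> = (ctranspose V ** X ** V) ** (ctranspose V ** X ** V)"
    by (simp only: matrix_mul_assoc)
  also have "\<dots> = diag_real (\<chi> i. b $ i * b $ i)"
    by (simp add: spec_diag[OF sp] diag_real_mult)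
  finally have LL: "ctranspose L ** (Y ** ctranspose Y) ** L = diag_real (\<chi> i. b $ i * b $ i)" .
  have "ctranspose (L ** ?D) ** (Y ** ctranspose Y) ** (L ** ?D)
      = ?D ** (ctranspose L ** (Y ** ctranspose Y) ** L) ** ?D"
    by (simp add: ctranspose_mult matrix_mul_assoc)
  also have "\<dots> = diag_real b"
  proof -
    have "1 / sqrt (b $ i) * (b $ i * b $ i) * (1 / sqrt (b $ i)) = b $ i" for i
      using b[of i] by (simp add: field_simps)
    then show ?thesis
      by (simp add: LL diag_real_mult)
  qed
  finally have "Re ((ctranspose (L ** ?D) ** (Y ** ctranspose Y) ** (L ** ?D)) $ i $ i) = b $ i" for i
    by (simp add: diag_real_def)
  moreover have "Y ** ctranspose Y \<in> psd_cone"
    using gram_psd[of "ctranspose Y"] by simp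
  ultimately show ?thesis
    using peierls[OF _ c normalize_columns[OF L b], of "Y ** ctranspose Y"] c
    by (simp add: trace_power_spec[OF sp, unfolded X_def] zpowr_def)
qed

lemma psd_sqrt:
  assumes "A \<in> psd_cone"
  obtains S where "ctranspose S = S" and "S ** S = A"
proof -
  obtain U d where sp: "spectral U d A" and d: "\<And>i. 0 \<le> d $ i"
    using psd_spec[OF assms] by metis
  define S where "S = U ** diag_real (\<chi> i. sqrt (d $ i)) ** ctranspose U"
  have U: "ctranspose U ** U = mat 1"
    using sp by (simp add: spectral_def unitary_def)
  have "S ** S = U ** diag_real (\<chi> i. sqrt (d $ i)) ** (ctranspose U ** U)
      ** diag_real (\<chi> i. sqrt (d $ i)) ** ctranspose U"
    by (simp only: S_def matrix_mul_assoc)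
  also have "\<dots> = U ** (diag_real (\<chi> i. sqrt (d $ i)) ** diag_real (\<chi> i. sqrt (d $ i))) ** ctranspose U"
    by (simp add: U matrix_mul_assoc)
  also have "\<dots> = A"
    using sp d by (simp add: diag_real_mult spectral_def)
  finally show thesis
    by (intro that[of S]) (simp_all add: S_def ctranspose_mult matrix_mul_assoc)
qed

text \<open>Let \<open>S = \<alpha>\<^bsup>1/2\<^esup>\<close> and let \<open>v\<^sub>i\<close>, \<open>u\<^sub>i\<close> be the right and left singular vectors of \<open>S Y\<close>. The
  singular values are \<open>\<langle>S u\<^sub>i, Y v\<^sub>i\<rangle>\<close>, so by Cauchy-Schwarz
  \<open>\<Gamma>\<^sub>i \<le> \<langle>u\<^sub>i, \<alpha> u\<^sub>i\<rangle> \<langle>v\<^sub>i, Y\<^sup>* Y v\<^sub>i\<rangle>\<close>. Young's inequality for numbers separates the two factors and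
  the Peierls inequality sums each of them up to a trace.\<close>

lemma trace_hoelder:
  fixes \<alpha> Y :: "complex^'n^'n"
  assumes \<alpha>: "\<alpha> \<in> psd_cone" and sp: "spectral V \<Gamma> (ctranspose Y ** \<alpha> ** Y)"
    and ab: "0 < a" "0 < b" "a + b \<le> 1"
  shows "(\<Sum>i\<in>UNIV. \<Gamma> $ i powr (1 / (a + b)))
    \<le> a / (a + b) * trace_power \<alpha> (1 / a) + b / (a + b) * trace_power (Y ** ctranspose Y) (1 / b)"
proof -
  have \<Gamma>: "0 \<le> \<Gamma> $ i" for i
    using spec_psd_nonneg[OF sp psd_cone_congruence[OF \<alpha>]] .
  have V: "unitary V"
    using sp by (simp add: spectral_def)
  obtain S where S: "ctranspose S = S" "S ** S = \<alpha>"
    using psd_sqrt[OF \<alpha>] by blast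
  define L where "L = S ** Y ** V"
  have "ctranspose L ** L = ctranspose V ** (ctranspose Y ** (S ** S) ** Y) ** V"
    by (simp add: L_def ctranspose_mult S(1) matrix_mul_assoc)
  then have L: "ctranspose L ** L = diag_real \<Gamma>"
    by (simp add: S spec_diag[OF sp])
  let ?D = "diag_real (\<chi> i. 1 / sqrt (\<Gamma> $ i))"
  define M where "M = L ** ?D"
  have M: "ctranspose M ** M = diag_indicator {i. 0 < \<Gamma> $ i}"
    unfolding M_def by (rule normalize_columns[OF L \<Gamma>])
  define P where "P = (\<lambda>i. Re ((ctranspose M ** \<alpha> ** M) $ i $ i))"
  define Q where "Q = (\<lambda>i. Re ((ctranspose V ** (ctranspose Y ** Y) ** V) $ i $ i))"
  have P: "P i = (norm (column i (S ** M)))\<^sup>2" for i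
  proof -
    have "ctranspose M ** (S ** S) ** M = ctranspose (S ** M) ** (S ** M)"
      by (simp only: ctranspose_mult S(1) matrix_mul_assoc)
    then show ?thesis
      by (simp add: P_def ctranspose_mult_nth cinner_self S(2))
  qed
  have Q: "Q i = (norm (column i (Y ** V)))\<^sup>2" for i
  proof -
    have "ctranspose V ** (ctranspose Y ** Y) ** V = ctranspose (Y ** V) ** (Y ** V)"
      by (simp add: ctranspose_mult matrix_mul_assoc)
    then show ?thesis
      by (simp add: Q_def ctranspose_mult_nth cinner_self)
  qed
  have \<Gamma>PQ: "\<Gamma> $ i \<le> P i * Q i" for i
  proof -
    have "ctranspose (S ** M) ** (Y ** V) = ?D ** (ctranspose L ** L)"
      by (simp add: M_def L_def ctranspose_mult S(1) matrix_mul_assoc)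
    also have "\<dots> = diag_real (\<chi> i. 1 / sqrt (\<Gamma> $ i) * \<Gamma> $ i)"
      by (simp add: L diag_real_mult)
    finally have "cinner (column i (S ** M)) (column i (Y ** V)) = of_real (1 / sqrt (\<Gamma> $ i) * \<Gamma> $ i)"
      by (simp add: diag_real_def flip: ctranspose_mult_nth)
    also have "1 / sqrt (\<Gamma> $ i) * \<Gamma> $ i = sqrt (\<Gamma> $ i)"
      using \<Gamma>[of i] by (simp add: real_div_sqrt)
    finally have "sqrt (\<Gamma> $ i) = column i (S ** M) \<bullet> column i (Y ** V)"
      by (simp flip: Re_cinner)
    also have "\<dots> \<le> norm (column i (S ** M)) * norm (column i (Y ** V))"
      by (rule norm_cauchy_schwarz)
    finally have "(sqrt (\<Gamma> $ i))\<^sup>2 \<le> (norm (column i (S ** M)) * norm (column i (Y ** V)))\<^sup>2"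
      using \<Gamma>[of i] by (intro power_mono) auto
    then show ?thesis
      using \<Gamma>[of i] by (simp add: P Q power_mult_distrib)
  qed
  let ?p = "a / (a + b)" and ?q = "b / (a + b)" and ?r = "1 / (a + b)"
  have q: "?q = 1 - ?p"
    using ab by (simp add: field_simps)
  have PQ: "0 \<le> P i" "0 \<le> Q i" for i
    by (simp_all add: P Q)
  have "\<Gamma> $ i powr ?r \<le> ?p * P i powr (1 / a) + ?q * Q i powr (1 / b)" for i
  proof -
    have "\<Gamma> $ i powr ?r \<le> (P i * Q i) powr ?r"
      using \<Gamma>PQ \<Gamma> ab by (intro powr_mono2) auto
    also have "\<dots> = (P i powr (1 / a)) powr ?p * (Q i powr (1 / b)) powr (1 - ?p)"
      using PQ ab unfolding q[symmetric] by (simp add: powr_mult powr_powr)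
    also have "\<dots> \<le> ?p * P i powr (1 / a) + (1 - ?p) * Q i powr (1 / b)"
      using ab by (intro weighted_am_gm) auto
    finally show ?thesis
      by (simp add: q)
  qed
  then have "(\<Sum>i\<in>UNIV. \<Gamma> $ i powr ?r) \<le> (\<Sum>i\<in>UNIV. ?p * P i powr (1 / a) + ?q * Q i powr (1 / b))"
    by (rule sum_mono)
  also have "\<dots> = ?p * (\<Sum>i\<in>UNIV. P i powr (1 / a)) + ?q * (\<Sum>i\<in>UNIV. Q i powr (1 / b))"
    by (simp add: sum.distrib sum_distrib_left)
  also have "\<dots> \<le> ?p * trace_power \<alpha> (1 / a) + ?q * trace_power (Y ** ctranspose Y) (1 / b)"
  proof (intro add_mono mult_left_mono)
    show "(\<Sum>i\<in>UNIV. P i powr (1 / a)) \<le> trace_power \<alpha> (1 / a)"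
      unfolding P_def using ab by (intro peierls[OF \<alpha> _ M]) auto
    have "diag_indicator UNIV = (mat 1 :: complex^'n^'n)"
      by (simp add: diag_indicator_def diag_real_1)
    then have "(\<Sum>i\<in>UNIV. Q i powr (1 / b)) \<le> trace_power (ctranspose Y ** Y) (1 / b)"
      unfolding Q_def using ab V by (intro peierls[OF gram_psd, of _ _ UNIV]) (auto simp: unitary_def)
    also have "\<dots> \<le> trace_power (Y ** ctranspose Y) (1 / b)"
      using ab by (intro trace_power_gram_commute_le) auto
    finally show "(\<Sum>i\<in>UNIV. Q i powr (1 / b)) \<le> trace_power (Y ** ctranspose Y) (1 / b)" .
  qed (use ab in auto)
  finally show ?thesis .
qed

section \<open>A variational formula for sums of smallest eigenvalues\<close>

text \<open>Let \<open>Q = C Y\<close>, an idempotent of rank \<open>|S|\<close>. For \<open>x\<close> in the range of \<open>Y\<^sup>*\<close>, the orthogonal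
  complement of the kernel of \<open>Q\<close>, the vector \<open>v = Q x\<close> is at least as long as \<open>x\<close>, and
  \<open>\<langle>v, N v\<rangle> = \<langle>x, Y\<^sup>* \<alpha> Y x\<rangle>\<close>. If the claimed bound failed, a dimension count would give \<open>x \<noteq> 0\<close> of
  this kind such that \<open>x\<close> is spanned by eigenvectors with \<open>\<Gamma>\<^sub>i \<le> t\<close> and \<open>v\<close> by eigenvectors with
  \<open>\<mu>\<^sub>i > t\<close>; these two facts contradict each other.\<close>

lemma eigenvalue_count:
  fixes N Y C \<alpha> :: "complex^'n^'n"
  assumes N: "spectral U \<mu> N" and \<gamma>: "spectral V \<Gamma> (ctranspose Y ** \<alpha> ** Y)"
    and YC: "Y ** C = diag_indicator S" and EY: "diag_indicator S ** Y = Y" and CNC: "ctranspose C ** N ** C = \<alpha>"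
    and t: "0 \<le> t"
  shows "card S \<le> card {i. t < \<Gamma> $ i} + card {i. \<mu> $ i \<le> t}"
proof (rule ccontr)
  assume less: "\<not> ?thesis"
  have UV: "unitary U" "unitary V"
    using N \<gamma> by (auto simp: spectral_def)
  define r :: "'n + 'n + 'n \<Rightarrow> complex^'n" where
    "r = case_sum (\<lambda>i. axis i 1) (case_sum (\<lambda>i. Y *v column i V)
      (\<lambda>i. ctranspose (C ** Y ** ctranspose Y) *v column i U))"
  \<comment> \<open>The unknown is \<open>y\<close> with support in \<open>S\<close> and \<open>x = Y\<^sup>* y\<close>; the equations force the support, then
    the absence of \<open>\<Gamma>\<^sub>i > t\<close> from \<open>x\<close>, then that of \<open>\<mu>\<^sub>i \<le> t\<close> from \<open>v\<close>.\<close>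
  define J where "J = (- S) <+> ({i. t < \<Gamma> $ i} <+> {i. \<mu> $ i \<le> t})"
  have "card (- S) = CARD('n) - card S" "card S \<le> CARD('n)"
    by (simp_all add: Compl_eq_Diff_UNIV card_Diff_subset card_mono)
  then have "card J < CARD('n)"
    using less unfolding J_def by (simp add: card_Plus)
  then obtain y where y: "y \<noteq> 0" "\<And>j. j \<in> J \<Longrightarrow> cinner (r j) y = 0"
    using homogeneous_system[of J r] by (auto simp: J_def)
  define x where "x = ctranspose Y *v y"
  define v where "v = C *v (Y *v x)"
  have "y $ i = 0" if "i \<notin> S" for i
  proof -
    have "cinner (axis i 1) y = y $ i"
      by (simp add: cinner_def axis_def if_distrib[of cnj] if_distrib[of "\<lambda>x. x * _"] cong: if_cong)
    moreover have "Inl i \<in> J"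
      using that by (auto simp: J_def)
    ultimately show ?thesis
      using y(2)[of "Inl i"] by (simp add: r_def)
  qed
  then have Ey: "diag_indicator S *v y = y"
    by (simp add: vec_eq_iff diag_indicator_def diag_real_def matrix_vector_mult_def
        if_distrib[of "\<lambda>x. x * _"] cong: if_cong)
  have col: "cinner (column i W) z = (ctranspose W *v z) $ i" for i z and W :: "complex^'n^'n"
    by (simp add: cinner_def column_def matrix_vector_mult_def)
  have Vx: "(ctranspose V *v x) $ i = 0" if "t < \<Gamma> $ i" for i
  proof -
    have "Inr (Inl i) \<in> J"
      using that by (auto simp: J_def)
    then show ?thesis
      using y(2)[of "Inr (Inl i)"] by (simp add: r_def x_def col[symmetric] cinner_adjoint)
  qed
  have Uv: "(ctranspose U *v v) $ i = 0" if "\<mu> $ i \<le> t" for i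
  proof -
    have "Inr (Inr i) \<in> J"
      using that by (auto simp: J_def)
    moreover have v: "v = (C ** Y ** ctranspose Y) *v y"
      by (simp add: v_def x_def matrix_vector_mul_assoc matrix_mul_assoc)
    have "(ctranspose U *v v) $ i = cinner (ctranspose (C ** Y ** ctranspose Y) *v column i U) y"
      unfolding v col[symmetric] by (rule cinner_adjoint)
    ultimately show ?thesis
      using y(2)[of "Inr (Inr i)"] by (simp add: r_def)
  qed
  have "x \<noteq> 0"
  proof
    assume "x = 0"
    have "ctranspose C *v x = ctranspose (Y ** C) *v y"
      by (simp add: x_def ctranspose_mult matrix_vector_mul_assoc)
    also have "\<dots> = y"
      by (simp add: YC Ey)
    finally show False
      using \<open>x = 0\<close> y(1) by simp
  qed
  have "cinner x v = cinner y ((Y ** C) *v (Y *v x))"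
    by (simp add: v_def x_def matrix_vector_mul_assoc cinner_adjoint ctranspose_mult matrix_mul_assoc)
  also have "\<dots> = cinner y (Y *v x)"
    by (simp add: YC matrix_vector_mul_assoc EY)
  also have "\<dots> = cinner x x"
    by (simp add: cinner_adjoint x_def)
  finally have "x \<bullet> x = x \<bullet> v"
    by (simp flip: Re_cinner)
  also have "\<dots> \<le> norm x * norm v"
    by (rule norm_cauchy_schwarz)
  finally have nxv: "norm x \<le> norm v"
    using \<open>x \<noteq> 0\<close> by (simp add: power2_eq_square flip: power2_norm_eq_inner)
  have "cinner v (N *v v) = cinner (Y *v x) (\<alpha> *v (Y *v x))"
    unfolding CNC[symmetric]
    by (simp add: v_def matrix_vector_mul_assoc cinner_adjoint ctranspose_mult matrix_mul_assoc)
  also have "\<dots> = cinner x ((ctranspose Y ** \<alpha> ** Y) *v x)"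
    by (simp add: matrix_vector_mul_assoc cinner_adjoint ctranspose_mult matrix_mul_assoc)
  finally have "v \<bullet> (N *v v) = x \<bullet> ((ctranspose Y ** \<alpha> ** Y) *v x)"
    by (simp flip: Re_cinner)
  also have "\<dots> \<le> t * (x \<bullet> x)"
    unfolding spec_quadratic_form[OF \<gamma>] unitary_norm[OF UV(2), of x] sum_distrib_left
  proof (rule sum_mono)
    fix i show "\<Gamma> $ i * (cmod ((ctranspose V *v x) $ i))\<^sup>2 \<le> t * (cmod ((ctranspose V *v x) $ i))\<^sup>2"
      using Vx[of i] by (cases "t < \<Gamma> $ i") (auto intro: mult_right_mono)
  qed
  also have "\<dots> \<le> t * (v \<bullet> v)"
    using nxv t by (intro mult_left_mono) (auto simp: power_mono simp flip: power2_norm_eq_inner)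
  also have "\<dots> < v \<bullet> (N *v v)"
  proof -
    have "v \<noteq> 0"
      using nxv \<open>x \<noteq> 0\<close> by auto
    have "\<exists>i. (ctranspose U *v v) $ i \<noteq> 0"
    proof (rule ccontr)
      assume "\<nexists>i. (ctranspose U *v v) $ i \<noteq> 0"
      then have "v \<bullet> v = 0"
        by (simp add: unitary_norm[OF UV(1), of v])
      with \<open>v \<noteq> 0\<close> show False
        by (simp only: inner_eq_zero_iff)
    qed
    then obtain i where i: "(ctranspose U *v v) $ i \<noteq> 0"
      by blast
    have le: "t * (cmod ((ctranspose U *v v) $ j))\<^sup>2 \<le> \<mu> $ j * (cmod ((ctranspose U *v v) $ j))\<^sup>2" for j
      using Uv[of j] by (cases "\<mu> $ j \<le> t") (auto intro: mult_right_mono)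
    have "t * (cmod ((ctranspose U *v v) $ i))\<^sup>2 < \<mu> $ i * (cmod ((ctranspose U *v v) $ i))\<^sup>2"
      using Uv[of i] i by (intro mult_strict_right_mono linorder_not_le[THEN iffD1]) auto
    with le have "(\<Sum>i\<in>UNIV. t * (cmod ((ctranspose U *v v) $ i))\<^sup>2)
        < (\<Sum>i\<in>UNIV. \<mu> $ i * (cmod ((ctranspose U *v v) $ i))\<^sup>2)"
      by (intro sum_strict_mono_ex1 ballI bexI[of _ i]) auto
    then show ?thesis
      by (simp only: spec_quadratic_form[OF N] unitary_norm[OF UV(1), of v] sum_distrib_left)
  qed
  finally show False
    by simp
qed

text \<open>The count says that the \<open>i\<close>-th smallest \<open>\<mu>\<close> is at most the \<open>i\<close>-th smallest among the \<open>k\<close>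
  largest entries of \<open>\<Gamma>\<close>.\<close>

lemma smallest_sum_le_of_count:
  fixes \<mu> \<Gamma> :: "real^'n"
  assumes count: "\<And>t. 0 \<le> t \<Longrightarrow> k \<le> card {i. t < \<Gamma> $ i} + card {i. \<mu> $ i \<le> t}"
    and \<mu>: "\<And>i. 0 \<le> \<mu> $ i" and \<Gamma>: "\<And>i. 0 \<le> \<Gamma> $ i" and k: "k \<le> CARD('n)" and r: "0 \<le> r"
  shows "smallest_sum k (\<chi> i. \<mu> $ i powr r) \<le> (\<Sum>i\<in>UNIV. \<Gamma> $ i powr r)"
proof -
  obtain \<sigma> where \<sigma>: "sorts \<sigma> \<Gamma>"
    using sorts_exists by blast
  obtain \<rho> where \<rho>: "sorts \<rho> \<mu>"
    using sorts_exists by blast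
  have bij: "bij_betw \<sigma> {..<CARD('n)} UNIV" "bij_betw \<rho> {..<CARD('n)} UNIV"
    using \<sigma> \<rho> by (auto simp: sorts_def)
  have inj: "inj_on \<sigma> {..<CARD('n)}" "inj_on \<rho> {..<CARD('n)}"
    using bij by (auto simp: bij_betw_def)
  \<comment> \<open>The \<open>k\<close> largest entries of \<open>\<Gamma>\<close> occupy the positions \<open>m, \<dots>, CARD('n) - 1\<close>.\<close>
  define m where "m = CARD('n) - k"
  have le: "\<mu> $ \<rho> i \<le> \<Gamma> $ \<sigma> (m + i)" if i: "i < k" for i
  proof (rule ccontr)
    assume *: "\<not> \<mu> $ \<rho> i \<le> \<Gamma> $ \<sigma> (m + i)"
    define t where "t = \<Gamma> $ \<sigma> (m + i)"
    have "{j. t < \<Gamma> $ j} \<subseteq> \<sigma> ` {m + i<..<CARD('n)}"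
    proof
      fix j assume j: "j \<in> {j. t < \<Gamma> $ j}"
      obtain l where l: "l < CARD('n)" "j = \<sigma> l"
        using bij(1) by (metis UNIV_I bij_betw_iff_bijections lessThan_iff)
      have "m + i < CARD('n)"
        using i k by (simp add: m_def)
      have "m + i < l"
      proof (rule ccontr)
        assume "\<not> m + i < l"
        then have "\<Gamma> $ \<sigma> l \<le> \<Gamma> $ \<sigma> (m + i)"
          using \<sigma> \<open>m + i < CARD('n)\<close> by (simp add: sorts_def)
        with j l(2) show False
          by (simp add: t_def)
      qed
      with l show "j \<in> \<sigma> ` {m + i<..<CARD('n)}"
        by simp
    qed
    then have "card {j. t < \<Gamma> $ j} \<le> card (\<sigma> ` {m + i<..<CARD('n)})"
      by (intro card_mono) auto
    also have "\<dots> \<le> card {m + i<..<CARD('n)}"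
      by (rule card_image_le) auto
    finally have 1: "card {j. t < \<Gamma> $ j} \<le> k - Suc i"
      using k by (simp add: m_def)
    have "{j. \<mu> $ j \<le> t} \<subseteq> \<rho> ` {..<i}"
    proof
      fix j assume j: "j \<in> {j. \<mu> $ j \<le> t}"
      obtain l where l: "l < CARD('n)" "j = \<rho> l"
        using bij(2) by (metis UNIV_I bij_betw_iff_bijections lessThan_iff)
      have "l < i"
      proof (rule ccontr)
        assume "\<not> l < i"
        then have "\<mu> $ \<rho> i \<le> \<mu> $ \<rho> l"
          using \<rho> l(1) by (simp add: sorts_def)
        with * j l(2) show False
          by (simp add: t_def)
      qed
      with l show "j \<in> \<rho> ` {..<i}"
        by simp
    qed
    then have "card {j. \<mu> $ j \<le> t} \<le> card (\<rho> ` {..<i})"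
      by (intro card_mono) auto
    also have "\<dots> \<le> i"
      using card_image_le[of "{..<i}" \<rho>] by simp
    finally have "k \<le> k - Suc i + i"
      using count[of t] 1 \<Gamma> by (simp add: t_def)
    then show False
      using i by simp
  qed
  have injk: "inj_on \<rho> {..<k}"
    using k by (intro inj_on_subset[OF inj(2)]) auto
  have injm: "inj_on (\<lambda>i. \<sigma> (m + i)) {..<k}"
    using k by (auto intro!: inj_onI simp: m_def dest: inj_onD[OF inj(1)])
  have "smallest_sum k (\<chi> i. \<mu> $ i powr r) \<le> (\<Sum>i\<in>\<rho> ` {..<k}. (\<chi> i. \<mu> $ i powr r) $ i)"
    by (rule smallest_sum_le) (simp add: card_image[OF injk])
  also have "\<dots> = (\<Sum>i<k. \<mu> $ \<rho> i powr r)"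
    by (simp add: sum.reindex[OF injk])
  also have "\<dots> \<le> (\<Sum>i<k. \<Gamma> $ \<sigma> (m + i) powr r)"
    using le \<mu> r by (intro sum_mono powr_mono2) auto
  also have "\<dots> = (\<Sum>i\<in>(\<lambda>i. \<sigma> (m + i)) ` {..<k}. \<Gamma> $ i powr r)"
    by (simp add: sum.reindex[OF injm])
  also have "\<dots> \<le> (\<Sum>i\<in>UNIV. \<Gamma> $ i powr r)"
    by (intro sum_mono2) auto
  finally show ?thesis .
qed

text \<open>The competitors of the variational formula. For \<open>E = diag_indicator S\<close>, columns of \<open>W\<close> and rows
  of \<open>R\<close> with index in \<open>S\<close> form biorthogonal systems, and \<open>W R\<close> is an oblique projection of rank
  \<open>|S|\<close>.\<close>

definition dual_pair :: "'n set \<Rightarrow> complex^'n^'n \<Rightarrow> complex^'n^'n \<Rightarrow> bool" where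
  "dual_pair S W R \<longleftrightarrow> R ** W = diag_indicator S \<and> diag_indicator S ** R = R"

text \<open>Here \<open>Q\<close> plays the role of \<open>B\<^bsup>b/2\<^esup>\<close>, with inverse \<open>Q'\<close>, and \<open>H\<close> that of \<open>K\<^sup>* A\<^sup>a K\<close>. The matrices
  \<open>Y = R Q\<close> and \<open>C = Q' W\<close> link the spectrum of \<open>Q H Q\<close> to that of \<open>Y\<^sup>* (W\<^sup>* H W) Y\<close>, whose power
  has a trace that the Hoelder inequality estimates.\<close>

lemma smallest_sum_variational_le:
  fixes H Q Q' W R :: "complex^'n^'n"
  assumes H: "H \<in> psd_cone"
    and Q: "ctranspose Q = Q" "ctranspose Q' = Q'" "Q ** Q' = mat 1"
    and sp: "spectral U \<mu> (Q ** H ** Q)"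
    and S: "card S = k" and WR: "dual_pair S W R"
    and ab: "0 < a" "0 < b" "a + b \<le> 1"
  shows "smallest_sum k (\<chi> i. \<mu> $ i powr (1 / (a + b)))
    \<le> a / (a + b) * trace_power (ctranspose W ** H ** W) (1 / a)
      + b / (a + b) * trace_power (R ** (Q ** Q) ** ctranspose R) (1 / b)"
proof -
  define \<alpha> where "\<alpha> = ctranspose W ** H ** W"
  have \<alpha>: "\<alpha> \<in> psd_cone"
    unfolding \<alpha>_def by (rule psd_cone_congruence[OF H])
  define Y where "Y = R ** Q"
  define C where "C = Q' ** W"
  have Q'Q: "Q' ** Q = mat 1"
    using Q(3) by (simp add: matrix_left_right_inverse)
  obtain V \<Gamma> where \<gamma>: "spectral V \<Gamma> (ctranspose Y ** \<alpha> ** Y)" and \<Gamma>: "\<And>i. 0 \<le> \<Gamma> $ i"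
    using psd_spec[OF psd_cone_congruence[OF \<alpha>]] by metis
  have "Q ** H ** Q \<in> psd_cone"
    using psd_cone_congruence[OF H, of Q] Q by simp
  then have \<mu>: "0 \<le> \<mu> $ i" for i
    by (rule spec_psd_nonneg[OF sp])
  have "Y ** C = R ** (Q ** Q') ** W"
    by (simp only: Y_def C_def matrix_mul_assoc)
  then have YC: "Y ** C = diag_indicator S"
    using WR Q by (simp add: dual_pair_def)
  have EY: "diag_indicator S ** Y = Y"
    using WR by (simp add: Y_def dual_pair_def matrix_mul_assoc)
  have "ctranspose C ** (Q ** H ** Q) ** C = ctranspose W ** (Q' ** Q) ** H ** (Q ** Q') ** W"
    by (simp only: C_def ctranspose_mult Q(1,2) matrix_mul_assoc)
  also have "\<dots> = \<alpha>"
    unfolding Q(3) Q'Q by (simp add: \<alpha>_def)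
  finally have CNC: "ctranspose C ** (Q ** H ** Q) ** C = \<alpha>" .
  have "smallest_sum k (\<chi> i. \<mu> $ i powr (1 / (a + b))) \<le> (\<Sum>i\<in>UNIV. \<Gamma> $ i powr (1 / (a + b)))"
    using eigenvalue_count[OF sp \<gamma> YC EY CNC] S \<mu> \<Gamma> ab card_mono[of UNIV S]
    by (intro smallest_sum_le_of_count) auto
  also have "\<dots> \<le> a / (a + b) * trace_power \<alpha> (1 / a) + b / (a + b) * trace_power (Y ** ctranspose Y) (1 / b)"
    by (rule trace_hoelder[OF \<alpha> \<gamma> ab])
  also have "Y ** ctranspose Y = R ** (Q ** Q) ** ctranspose R"
    by (simp add: Y_def ctranspose_mult Q matrix_mul_assoc)
  finally show ?thesis
    by (simp add: \<alpha>_def)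
qed

lemma spec_diag_real: "spectral (mat 1) d (diag_real d)"
  by (simp add: spectral_def unitary_def)

lemma powr_half_mult_self: "x powr (c / 2) * x powr (c / 2) = x powr c" for x c :: real
  by (simp flip: powr_add)

text \<open>With \<open>W = Q U E (\<mu> + \<eta>)\<^bsup>-q/2\<^esup>\<close> and \<open>R = E (\<mu> + \<eta>)\<^bsup>q/2\<^esup> U\<^sup>* Q'\<close>, \<open>q = b/(a+b)\<close>, both matrices under
  the traces become diagonal. The shift \<open>\<eta>\<close> keeps the negative power finite when some \<open>\<mu>\<^sub>i\<close>
  vanishes.\<close>

lemma smallest_sum_variational_attained:
  fixes H Q Q' :: "complex^'n^'n"
  assumes Q: "ctranspose Q = Q" "ctranspose Q' = Q'" "Q ** Q' = mat 1"
    and sp: "spectral U \<mu> (Q ** H ** Q)" and \<mu>: "\<And>i. 0 \<le> \<mu> $ i"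
    and ab: "0 < a" "0 < b" and \<eta>: "0 < \<eta>"
  obtains W R where "dual_pair S W R"
    and "a / (a + b) * trace_power (ctranspose W ** H ** W) (1 / a)
      + b / (a + b) * trace_power (R ** (Q ** Q) ** ctranspose R) (1 / b)
      \<le> (\<Sum>i\<in>S. (\<mu> $ i + \<eta>) powr (1 / (a + b)))"
proof -
  let ?q = "b / (a + b)" and ?p = "a / (a + b)"
  have U: "ctranspose U ** U = mat 1"
    using sp by (simp add: spectral_def unitary_def)
  have Q'Q: "Q' ** Q = mat 1"
    using Q(3) by (simp add: matrix_left_right_inverse)
  define w :: "real^'n" where "w = (\<chi> i. if i \<in> S then (\<mu> $ i + \<eta>) powr (- ?q / 2) else 0)"
  define \<rho> :: "real^'n" where "\<rho> = (\<chi> i. if i \<in> S then (\<mu> $ i + \<eta>) powr (?q / 2) else 0)"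
  define W where "W = Q ** U ** diag_real w"
  define R where "R = diag_real \<rho> ** ctranspose U ** Q'"
  have pos: "\<mu> $ i + \<eta> > 0" for i
    using \<mu>[of i] \<eta> by simp
  have "R ** W = diag_real \<rho> ** (ctranspose U ** (Q' ** Q) ** U) ** diag_real w"
    by (simp only: R_def W_def matrix_mul_assoc)
  also have "\<dots> = diag_indicator S"
  proof -
    have "\<rho> $ i * w $ i = (if i \<in> S then 1 else 0)" for i
      using pos[of i] by (simp add: \<rho>_def w_def flip: powr_add)
    then show ?thesis
      by (simp add: Q'Q U diag_real_mult diag_indicator_def)
  qed
  finally have RW: "R ** W = diag_indicator S" .
  have "(if i \<in> S then 1 else 0) * \<rho> $ i = \<rho> $ i" for i
    by (simp add: \<rho>_def)
  then have "diag_indicator S ** diag_real \<rho> = diag_real \<rho>"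
    by (simp only: diag_indicator_def diag_real_mult vec_lambda_beta vec_lambda_eta)
  then have "diag_indicator S ** R = R"
    by (simp add: R_def matrix_mul_assoc)
  with RW have WR: "dual_pair S W R"
    by (simp add: dual_pair_def)
  have "ctranspose W ** H ** W = diag_real w ** (ctranspose U ** (Q ** H ** Q) ** U) ** diag_real w"
    by (simp add: W_def ctranspose_mult Q matrix_mul_assoc)
  also have "\<dots> = diag_real (\<chi> i. w $ i * \<mu> $ i * w $ i)"
    by (simp add: spec_diag[OF sp] diag_real_mult)
  finally have \<alpha>: "ctranspose W ** H ** W = diag_real (\<chi> i. w $ i * \<mu> $ i * w $ i)" .
  have "R ** (Q ** Q) ** ctranspose R
      = diag_real \<rho> ** (ctranspose U ** (Q' ** Q) ** (Q ** Q') ** U) ** diag_real \<rho>"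
    by (simp add: R_def ctranspose_mult Q(1,2) matrix_mul_assoc)
  also have "\<dots> = diag_real (\<chi> i. \<rho> $ i * \<rho> $ i)"
    by (simp add: Q'Q Q(3) U diag_real_mult)
  finally have \<beta>: "R ** (Q ** Q) ** ctranspose R = diag_real (\<chi> i. \<rho> $ i * \<rho> $ i)" .
  have "1 - ?q = ?p"
    using ab by (simp add: field_simps)
  moreover have "?p / a = 1 / (a + b)" "?q / b = 1 / (a + b)"
    using ab by simp_all
  ultimately have pq: "?p / a = 1 / (a + b)" "?q / b = 1 / (a + b)" "1 - ?q = ?p"
    by auto
  have 1: "trace_power (ctranspose W ** H ** W) (1 / a) \<le> (\<Sum>i\<in>S. (\<mu> $ i + \<eta>) powr (1 / (a + b)))"
  proof -
    have "zpowr (w $ i * \<mu> $ i * w $ i) (1 / a) \<le> (if i \<in> S then (\<mu> $ i + \<eta>) powr (1 / (a + b)) else 0)" for i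
    proof (cases "i \<in> S")
      case True
      have "w $ i * \<mu> $ i * w $ i \<le> w $ i * (\<mu> $ i + \<eta>) * w $ i"
        using \<eta> by (simp add: w_def mult_left_mono mult_right_mono)
      also have "\<dots> = (w $ i * w $ i) * (\<mu> $ i + \<eta>)"
        by (simp only: mult_ac)
      also have "\<dots> = (\<mu> $ i + \<eta>) powr (- ?q) * (\<mu> $ i + \<eta>) powr 1"
        using True pos[of i] by (simp only: w_def vec_lambda_beta if_True powr_half_mult_self powr_one)
      also have "\<dots> = (\<mu> $ i + \<eta>) powr ?p"
        unfolding pq(3)[symmetric] by (simp only: flip: powr_add) simp
      finally have "(w $ i * \<mu> $ i * w $ i) powr (1 / a) \<le> ((\<mu> $ i + \<eta>) powr ?p) powr (1 / a)"
        using ab \<mu>[of i] by (intro powr_mono2) (auto simp: w_def)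
      then show ?thesis
        using True ab pq(1) by (simp add: zpowr_def powr_powr)
    qed (use ab in \<open>simp add: w_def zpowr_def\<close>)
    then have "trace_power (ctranspose W ** H ** W) (1 / a)
        \<le> (\<Sum>i\<in>UNIV. if i \<in> S then (\<mu> $ i + \<eta>) powr (1 / (a + b)) else 0)"
      unfolding \<alpha> trace_power_spec[OF spec_diag_real] by (intro sum_mono) simp
    then show ?thesis
      by (simp add: sum.If_cases)
  qed
  have 2: "trace_power (R ** (Q ** Q) ** ctranspose R) (1 / b) = (\<Sum>i\<in>S. (\<mu> $ i + \<eta>) powr (1 / (a + b)))"
  proof -
    have "zpowr (\<rho> $ i * \<rho> $ i) (1 / b) = (if i \<in> S then (\<mu> $ i + \<eta>) powr (1 / (a + b)) else 0)" for i
    proof (cases "i \<in> S")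
      case True
      then have "\<rho> $ i * \<rho> $ i = (\<mu> $ i + \<eta>) powr ?q"
        by (simp only: \<rho>_def vec_lambda_beta if_True powr_half_mult_self)
      then show ?thesis
        using True ab pq(2) by (simp add: zpowr_def powr_powr)
    qed (use ab in \<open>simp add: \<rho>_def zpowr_def\<close>)
    then show ?thesis
      unfolding \<beta> trace_power_spec[OF spec_diag_real] by (simp add: sum.If_cases)
  qed
  have "?p * trace_power (ctranspose W ** H ** W) (1 / a)
      + ?q * trace_power (R ** (Q ** Q) ** ctranspose R) (1 / b)
      \<le> ?p * (\<Sum>i\<in>S. (\<mu> $ i + \<eta>) powr (1 / (a + b))) + ?q * (\<Sum>i\<in>S. (\<mu> $ i + \<eta>) powr (1 / (a + b)))"
    using 1 2 ab by (intro add_mono mult_left_mono) auto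
  also have "\<dots> = (\<Sum>i\<in>S. (\<mu> $ i + \<eta>) powr (1 / (a + b)))"
    using ab by (simp add: pq(3)[symmetric] left_diff_distrib)
  finally show thesis
    by (rule that[OF WR])
qed

section \<open>Concavity for positive exponents and invertible \<open>B\<close>\<close>

definition lieb_matrix ::
    "complex^'n^'m \<Rightarrow> real \<Rightarrow> real \<Rightarrow> complex^'m^'m \<Rightarrow> complex^'n^'n \<Rightarrow> complex^'n^'n" where
  "lieb_matrix K a b A B =
     psd_power B (b / 2) ** ctranspose K ** psd_power A a ** K ** psd_power B (b / 2)"

lemma psd_power_ctranspose: "B \<in> psd_cone \<Longrightarrow> ctranspose (psd_power B c) = psd_power B c"
  using psd_cone_hermitian[OF psd_power_psd, of B c] by (simp add: hermitian_def)

lemma lieb_matrix_psd: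
  assumes "A \<in> psd_cone" and "B \<in> psd_cone"
  shows "lieb_matrix K a b A B \<in> psd_cone"
proof -
  have "ctranspose (K ** psd_power B (b / 2)) ** psd_power A a ** (K ** psd_power B (b / 2))
      \<in> psd_cone"
    by (intro psd_cone_congruence psd_power_psd assms)
  then show ?thesis
    by (simp add: lieb_matrix_def ctranspose_mult psd_power_ctranspose[OF assms(2)] matrix_mul_assoc)
qed

lemma spec_add_mat_1:
  assumes "spectral U d A"
  shows "spectral U (\<chi> i. d $ i + e) (A + e *\<^sub>R mat 1)"
proof -
  have "diag_real (\<chi> i. d $ i + e) = diag_real d + e *\<^sub>R mat 1"
    by (simp add: vec_eq_iff diag_real_def mat_def) (simp add: scaleR_conv_of_real)
  then show ?thesis
    using assms
    by (simp add: spectral_def matrix_add_ldistrib matrix_add_rdistrib scaleR_matrix_mult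
        matrix_mult_scaleR unitary_def)
qed

lemma psd_power_add:
  assumes "spectral U d B" and "\<And>i. 0 < d $ i"
  shows "psd_power B x ** psd_power B y = psd_power B (x + y)"
proof -
  have U: "ctranspose U ** U = mat 1"
    using assms by (simp add: spectral_def unitary_def)
  have pw: "psd_power B z = U ** diag_real (\<chi> i. zpowr (d $ i) z) ** ctranspose U" for z
    using spec_psd_power[OF assms(1)] by (simp add: spectral_def)
  have z: "zpowr (d $ i) x * zpowr (d $ i) y = zpowr (d $ i) (x + y)" for i
    using assms(2)[of i] by (auto simp: zpowr_def powr_add simp flip: powr_add)
  have "psd_power B x ** psd_power B y
    = U ** (diag_real (\<chi> i. zpowr (d $ i) x) ** (ctranspose U ** U)
      ** diag_real (\<chi> i. zpowr (d $ i) y)) ** ctranspose U"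
    unfolding pw by (simp only: matrix_mul_assoc)
  also have "\<dots> = psd_power B (x + y)"
    by (simp add: U pw z diag_real_mult)
  finally show ?thesis .
qed

lemma psd_power_0: "B \<in> psd_cone \<Longrightarrow> psd_power B 0 = mat 1"
proof (elim psd_spec)
  fix U d assume "spectral U d B"
  then show "psd_power B 0 = mat 1"
    using spec_psd_power[of U d B 0]
    by (simp add: spectral_def zpowr_def diag_real_1 unitary_def)
qed

text \<open>A nearly optimal pair \<open>(W, R)\<close> at the convex combination is a competitor at both end points, so
  that Epstein's theorem for its two trace terms gives the inequality up to \<open>\<eta>\<close>.\<close>

lemma smallest_sum_concave_shifted:
  fixes K :: "complex^'n^'m"
  assumes ab: "0 < a" "0 < b" "a + b \<le> 1" and \<epsilon>: "0 < \<epsilon>"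
    and A: "A1 \<in> psd_cone" "A2 \<in> psd_cone" and B: "B1 \<in> psd_cone" "B2 \<in> psd_cone"
    and st: "0 \<le> s" "0 \<le> t" "s + t = 1" and k: "k \<le> CARD('n)"
    and sp: "spectral U \<mu> (lieb_matrix K a b (s *\<^sub>R A1 + t *\<^sub>R A2) (s *\<^sub>R B1 + t *\<^sub>R B2 + \<epsilon> *\<^sub>R mat 1))"
    and sp1: "spectral U1 \<mu>1 (lieb_matrix K a b A1 (B1 + \<epsilon> *\<^sub>R mat 1))"
    and sp2: "spectral U2 \<mu>2 (lieb_matrix K a b A2 (B2 + \<epsilon> *\<^sub>R mat 1))"
  shows "s * smallest_sum k (\<chi> i. \<mu>1 $ i powr (1 / (a + b))) + t * smallest_sum k (\<chi> i. \<mu>2 $ i powr (1 / (a + b)))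
    \<le> smallest_sum k (\<chi> i. \<mu> $ i powr (1 / (a + b)))"
proof -
  let ?r = "1 / (a + b)"
  define A0 where "A0 = s *\<^sub>R A1 + t *\<^sub>R A2"
  define B0 where "B0 = s *\<^sub>R B1 + t *\<^sub>R B2"
  have A0: "A0 \<in> psd_cone" and B0: "B0 \<in> psd_cone"
    unfolding A0_def B0_def using A B st by (auto intro: psd_cone_combination)
  define sh :: "complex^'n^'n \<Rightarrow> complex^'n^'n" where "sh = (\<lambda>B. B + \<epsilon> *\<^sub>R mat 1)"
  define H where "H = (\<lambda>A. ctranspose K ** psd_power A a ** K)"
  define Q where "Q = (\<lambda>B. psd_power (sh B) (b / 2))"
  define Q' where "Q' = (\<lambda>B. psd_power (sh B) (- (b / 2)))"
  have H: "H A \<in> psd_cone" if "A \<in> psd_cone" for A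
    unfolding H_def by (intro psd_cone_congruence psd_power_psd that)
  have shift: "\<exists>U d. spectral U d (sh B) \<and> (\<forall>i. 0 < d $ i)" if B: "B \<in> psd_cone" for B
  proof -
    obtain U d where "spectral U d B" "\<And>i. 0 \<le> d $ i"
      using psd_spec[OF B] by metis
    then show ?thesis
      using \<epsilon> unfolding sh_def
      by (intro exI[of _ U] exI[of _ "\<chi> i. d $ i + \<epsilon>"]) (auto intro: spec_add_mat_1 add_nonneg_pos)
  qed
  have sh_psd: "sh B \<in> psd_cone" if "B \<in> psd_cone" for B
    using shift[OF that] by (metis spec_psd less_imp_le)
  have Q: "ctranspose (Q B) = Q B" "ctranspose (Q' B) = Q' B" "Q B ** Q' B = mat 1"
      "Q B ** Q B = psd_power (sh B) b" if B: "B \<in> psd_cone" for B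
  proof -
    obtain U d where sh: "spectral U d (sh B)" "\<And>i. 0 < d $ i"
      using shift[OF B] by auto
    show "ctranspose (Q B) = Q B" "ctranspose (Q' B) = Q' B"
      by (simp_all add: Q_def Q'_def psd_power_ctranspose sh_psd[OF B])
    show "Q B ** Q' B = mat 1" "Q B ** Q B = psd_power (sh B) b"
      by (simp_all add: Q_def Q'_def psd_power_add[OF sh] psd_power_0 sh_psd[OF B])
  qed
  have N: "lieb_matrix K a b A (B + \<epsilon> *\<^sub>R mat 1) = Q B ** H A ** Q B" for A B
    by (simp add: lieb_matrix_def Q_def H_def sh_def matrix_mul_assoc)
  have sp: "spectral U \<mu> (Q B0 ** H A0 ** Q B0)"
    and sp1: "spectral U1 \<mu>1 (Q B1 ** H A1 ** Q B1)"
    and sp2: "spectral U2 \<mu>2 (Q B2 ** H A2 ** Q B2)"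
    using sp sp1 sp2 by (simp_all add: N A0_def B0_def)
  have "Q B0 ** H A0 ** Q B0 \<in> psd_cone"
    using psd_cone_congruence[OF H[OF A0], of "Q B0"] Q[OF B0] by simp
  then have \<mu>: "0 \<le> \<mu> $ i" for i
    by (rule spec_psd_nonneg[OF sp])
  obtain S where S: "card S = k" "smallest_sum k (\<chi> i. \<mu> $ i powr ?r) = (\<Sum>i\<in>S. \<mu> $ i powr ?r)"
    using smallest_sum_attained[OF k, of "\<chi> i. \<mu> $ i powr ?r"] by auto
  let ?J = "\<lambda>W R A B. a / (a + b) * trace_power (ctranspose W ** H A ** W) (1 / a)
    + b / (a + b) * trace_power (R ** (Q B ** Q B) ** ctranspose R) (1 / b)"
  have conc: "s * ?J W R A1 B1 + t * ?J W R A2 B2 \<le> ?J W R A0 B0" for W R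
  proof -
    have "ctranspose W ** H A ** W = ctranspose (K ** W) ** psd_power A a ** (K ** W)" for A
      by (simp add: H_def ctranspose_mult matrix_mul_assoc)
    then have 1: "s * trace_power (ctranspose W ** H A1 ** W) (1 / a)
        + t * trace_power (ctranspose W ** H A2 ** W) (1 / a)
        \<le> trace_power (ctranspose W ** H A0 ** W) (1 / a)"
      using epstein_concavity[of a A1 A2 s t "K ** W"] ab A st by (simp add: A0_def)
    have "s *\<^sub>R sh B1 + t *\<^sub>R sh B2 = s *\<^sub>R B1 + t *\<^sub>R B2 + (s + t) *\<^sub>R (\<epsilon> *\<^sub>R mat 1)"
      by (simp only: sh_def scaleR_add_right scaleR_add_left add_ac)
    then have "s *\<^sub>R sh B1 + t *\<^sub>R sh B2 = sh B0"
      by (simp add: st sh_def B0_def)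
    then have 2: "s * trace_power (R ** (Q B1 ** Q B1) ** ctranspose R) (1 / b)
        + t * trace_power (R ** (Q B2 ** Q B2) ** ctranspose R) (1 / b)
        \<le> trace_power (R ** (Q B0 ** Q B0) ** ctranspose R) (1 / b)"
      using epstein_concavity[of b "sh B1" "sh B2" s t "ctranspose R"] ab B st
      by (simp add: Q(4) B B0 sh_psd)
    have "s * ?J W R A1 B1 + t * ?J W R A2 B2
      = a / (a + b) * (s * trace_power (ctranspose W ** H A1 ** W) (1 / a)
        + t * trace_power (ctranspose W ** H A2 ** W) (1 / a))
      + b / (a + b) * (s * trace_power (R ** (Q B1 ** Q B1) ** ctranspose R) (1 / b)
        + t * trace_power (R ** (Q B2 ** Q B2) ** ctranspose R) (1 / b))"
      by (simp only: distrib_left mult_ac add_ac)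
    also have "\<dots> \<le> ?J W R A0 B0"
      using 1 2 ab by (intro add_mono mult_left_mono) auto
    finally show ?thesis .
  qed
  let ?L = "s * smallest_sum k (\<chi> i. \<mu>1 $ i powr ?r) + t * smallest_sum k (\<chi> i. \<mu>2 $ i powr ?r)"
  have bound: "?L \<le> (\<Sum>i\<in>S. (\<mu> $ i + \<eta>) powr ?r)" if \<eta>: "0 < \<eta>" for \<eta>
  proof -
    obtain W R where WR: "dual_pair S W R"
      and J: "?J W R A0 B0 \<le> (\<Sum>i\<in>S. (\<mu> $ i + \<eta>) powr ?r)"
      using smallest_sum_variational_attained[OF Q(1-3)[OF B0] sp \<mu> ab(1,2) \<eta>] by blast
    have "?L \<le> s * ?J W R A1 B1 + t * ?J W R A2 B2"
      using smallest_sum_variational_le[OF H[OF A(1)] Q(1-3)[OF B(1)] sp1 S(1) WR ab]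
        smallest_sum_variational_le[OF H[OF A(2)] Q(1-3)[OF B(2)] sp2 S(1) WR ab] st
      by (intro add_mono mult_left_mono) auto
    also have "\<dots> \<le> ?J W R A0 B0"
      by (rule conc)
    finally show ?thesis
      using J by linarith
  qed
  \<comment> \<open>It remains to let \<open>\<eta>\<close> tend to 0.\<close>
  have "((\<lambda>\<eta>. \<Sum>i\<in>S. (\<mu> $ i + \<eta>) powr ?r) \<longlongrightarrow> (\<Sum>i\<in>S. (\<mu> $ i + 0) powr ?r)) (at_right 0)"
  proof (intro tendsto_sum tendsto_powr' tendsto_add tendsto_const)
    fix i
    have "eventually (\<lambda>\<eta>. 0 \<le> \<mu> $ i + \<eta>) (at_right (0::real))"
      using \<mu>[of i] by (auto simp: eventually_at_filter intro: always_eventually)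
    then show "\<mu> $ i + 0 \<noteq> 0 \<or> 0 < ?r \<and> (\<forall>\<^sub>F \<eta> in at_right 0. 0 \<le> \<mu> $ i + \<eta>)"
      using ab by auto
  qed (rule tendsto_ident_at)
  moreover have "eventually (\<lambda>\<eta>. ?L \<le> (\<Sum>i\<in>S. (\<mu> $ i + \<eta>) powr ?r)) (at_right 0)"
    using bound by (auto simp: eventually_at_filter intro: always_eventually)
  ultimately have "?L \<le> (\<Sum>i\<in>S. (\<mu> $ i + 0) powr ?r)"
    by (intro tendsto_lowerbound) auto
  then show ?thesis
    by (simp add: S(2))
qed

section \<open>Passage to the limit\<close>

lemma tendsto_matrix_mult:
  fixes X :: "'a \<Rightarrow> complex^'n^'m" and Y :: "'a \<Rightarrow> complex^'l^'n"
  assumes "(X \<longlongrightarrow> x) F" and "(Y \<longlongrightarrow> y) F"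
  shows "((\<lambda>j. X j ** Y j) \<longlongrightarrow> x ** y) F"
  unfolding matrix_matrix_mult_def
  by (intro tendsto_vec_lambda tendsto_sum tendsto_mult tendsto_vec_nth assms)

lemma tendsto_ctranspose:
  assumes "(X \<longlongrightarrow> x) F"
  shows "((\<lambda>j. ctranspose (X j)) \<longlongrightarrow> ctranspose x) F"
  unfolding ctranspose_def by (intro tendsto_vec_lambda tendsto_cnj tendsto_vec_nth assms)

lemma tendsto_diag_real:
  fixes d :: "'a \<Rightarrow> real^'n"
  assumes "(d \<longlongrightarrow> d') F"
  shows "((\<lambda>j. diag_real (d j)) \<longlongrightarrow> diag_real d') F"
  unfolding diag_real_def
proof (intro tendsto_vec_lambda)
  fix i j :: 'n
  show "((\<lambda>k. if i = j then complex_of_real (d k $ i) else 0) \<longlongrightarrow>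
      (if i = j then complex_of_real (d' $ i) else 0)) F"
    by (cases "i = j") (auto intro: tendsto_of_real tendsto_vec_nth[OF assms])
qed

lemma unitary_norm_le:
  fixes U :: "complex^'n^'n"
  assumes "unitary U"
  shows "norm U \<le> of_nat (CARD('n) * CARD('n))"
proof -
  have "ctranspose U ** U = diag_indicator UNIV"
    using assms by (simp add: unitary_def diag_indicator_def diag_real_1)
  then have row: "(\<Sum>j\<in>UNIV. (cmod (U $ i $ j))\<^sup>2) \<le> 1" for i
    by (rule partial_isometry_row_sum_le_1)
  have entry: "cmod (U $ i $ j) \<le> 1" for i j
  proof -
    have "(cmod (U $ i $ j))\<^sup>2 \<le> (\<Sum>j\<in>UNIV. (cmod (U $ i $ j))\<^sup>2)"
      by (rule member_le_sum) auto
    then have "(cmod (U $ i $ j))\<^sup>2 \<le> 1\<^sup>2"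
      using row[of i] by simp
    then show ?thesis
      by (rule power2_le_imp_le) simp
  qed
  have "norm U \<le> (\<Sum>i\<in>UNIV. norm (U $ i))"
    unfolding norm_vec_def[of U] by (rule L2_set_le_sum) simp
  also have "\<dots> \<le> (\<Sum>i\<in>(UNIV::'n set). \<Sum>j\<in>(UNIV::'n set). cmod (U $ i $ j))"
    unfolding norm_vec_def[of "U $ _"] by (intro sum_mono L2_set_le_sum) simp
  also have "\<dots> \<le> (\<Sum>i\<in>(UNIV::'n set). \<Sum>j\<in>(UNIV::'n set). 1)"
    by (intro sum_mono entry)
  finally show ?thesis
    by simp
qed

text \<open>The unitary matrices form a bounded set, so a subsequence converges; the eigenvalues follow,
  being the diagonal of \<open>U\<^sup>* N U\<close>.\<close>

lemma spec_subsequence_limit: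
  fixes N :: "nat \<Rightarrow> complex^'n^'n"
  assumes N: "N \<longlonglongrightarrow> N'" and sp: "\<And>j. spectral (U j) (d j) (N j)"
  obtains g U' d' where "strict_mono g" and "spectral U' d' N'" and "(\<lambda>j. d (g j)) \<longlonglongrightarrow> d'"
proof -
  have un: "unitary (U j)" for j
    using sp by (simp add: spectral_def)
  have "seq_compact (cball (0 :: complex^'n^'n) (of_nat (CARD('n) * CARD('n))))"
    by (intro compact_imp_seq_compact compact_cball)
  moreover have "\<forall>j. U j \<in> cball 0 (of_nat (CARD('n) * CARD('n)))"
    using unitary_norm_le[OF un] by simp
  ultimately obtain U' g where g: "strict_mono g" "(U \<circ> g) \<longlonglongrightarrow> U'"
    unfolding seq_compact_def by blast
  have U': "(\<lambda>j. U (g j)) \<longlonglongrightarrow> U'"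
    using g by (simp add: o_def)
  have Ng: "(\<lambda>j. N (g j)) \<longlonglongrightarrow> N'"
    using LIMSEQ_subseq_LIMSEQ[OF N g(1)] by (simp add: o_def)
  have "(\<lambda>j. mat 1) \<longlonglongrightarrow> ctranspose U' ** U'"
    using tendsto_matrix_mult[OF tendsto_ctranspose[OF U'] U'] un by (simp add: unitary_def)
  then have "ctranspose U' ** U' = mat 1"
    by (metis LIMSEQ_const_iff)
  then have unU': "unitary U'"
    by (simp add: unitary_def matrix_left_right_inverse)
  define d' where "d' = (\<chi> i. Re ((ctranspose U' ** N' ** U') $ i $ i))"
  have "(\<lambda>j. \<chi> i. Re ((ctranspose (U (g j)) ** N (g j) ** U (g j)) $ i $ i)) \<longlonglongrightarrow> d'"
    unfolding d'_def
    by (intro tendsto_vec_lambda tendsto_Re tendsto_vec_nth tendsto_matrix_mult tendsto_ctranspose U' Ng)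
  then have d: "(\<lambda>j. d (g j)) \<longlonglongrightarrow> d'"
    by (simp add: spec_diag[OF sp] diag_real_def)
  have "(\<lambda>j. U (g j) ** diag_real (d (g j)) ** ctranspose (U (g j)))
      \<longlonglongrightarrow> U' ** diag_real d' ** ctranspose U'"
    by (intro tendsto_matrix_mult tendsto_ctranspose tendsto_diag_real U' d)
  then have "(\<lambda>j. N (g j)) \<longlonglongrightarrow> U' ** diag_real d' ** ctranspose U'"
    using sp by (simp add: spectral_def)
  then have "N' = U' ** diag_real d' ** ctranspose U'"
    using Ng LIMSEQ_unique by blast
  then have "spectral U' d' N'"
    using unU' by (simp add: spectral_def)
  with g(1) d show thesis
    using that by blast
qed

lemma tendsto_smallest_sum:
  fixes x :: "'a \<Rightarrow> real^'n"
  assumes x: "(x \<longlongrightarrow> x') F" and k: "k \<le> CARD('n)"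
  shows "((\<lambda>j. smallest_sum k (x j)) \<longlongrightarrow> smallest_sum k x') F"
proof -
  have Min: "((\<lambda>j. Min ((\<lambda>S. \<Sum>i\<in>S. x j $ i) ` \<S>)) \<longlongrightarrow> Min ((\<lambda>S. \<Sum>i\<in>S. x' $ i) ` \<S>)) F"
    if "finite \<S>" "\<S> \<noteq> {}" for \<S> :: "'n set set"
    using that
  proof (induction rule: finite_ne_induct)
    case (singleton S)
    then show ?case
      by (simp add: tendsto_sum tendsto_vec_nth x)
  next
    case (insert S \<S>)
    have "((\<lambda>j. min (\<Sum>i\<in>S. x j $ i) (Min ((\<lambda>S. \<Sum>i\<in>S. x j $ i) ` \<S>)))
        \<longlongrightarrow> min (\<Sum>i\<in>S. x' $ i) (Min ((\<lambda>S. \<Sum>i\<in>S. x' $ i) ` \<S>))) F"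
      by (intro tendsto_min tendsto_sum tendsto_vec_nth x insert.IH)
    with insert.hyps show ?case
      by simp
  qed
  obtain S :: "'n set" where "card S = k"
    using obtain_subset_with_card_n[OF k] by auto
  then show ?thesis
    unfolding smallest_sum_def by (intro Min) auto
qed

lemma smallest_sum_spec_unique:
  assumes "spectral U d A" and "spectral V e A"
  shows "smallest_sum k (\<chi> i. f (d $ i)) = smallest_sum k (\<chi> i. f (e $ i))"
proof -
  obtain \<pi> where "\<pi> permutes UNIV" "\<And>i. d $ i = e $ \<pi> i"
    using spec_permutes[OF assms] by blast
  then show ?thesis
    using smallest_sum_permute[of \<pi> k "\<chi> i. f (e $ i)"] by simp
qed

text \<open>The exponent is regularized together with the base because \<open>\<epsilon>\<^bsup>h\<epsilon>\<^esup>\<close> tends to 1, which is the value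
  of \<open>zpowr 0 0\<close>. The factor \<open>h\<close> is 1 for \<open>A\<close> and 1/2 for \<open>B\<close>.\<close>

lemma tendsto_zpowr_regularized:
  fixes x a h :: real
  assumes "0 \<le> x" "0 \<le> a" "0 < h"
  shows "((\<lambda>e. zpowr (x + e) (h * ((a + e) / (1 + 2 * e)))) \<longlongrightarrow> zpowr x (h * a)) (at_right 0)"
proof -
  have "((\<lambda>e. (x + e) powr (h * ((a + e) / (1 + 2 * e)))) \<longlongrightarrow> zpowr x (h * a)) (at_right 0)"
  proof (cases "x = 0 \<and> a = 0")
    case True
    have "((\<lambda>e. e powr (h * (e / (1 + 2 * e)))) \<longlongrightarrow> 1) (at_right 0)"
      using assms by real_asymp
    with True show ?thesis
      by (simp add: zpowr_def)
  next
    case False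
    have "((\<lambda>e. (x + e) powr (h * ((a + e) / (1 + 2 * e))))
        \<longlongrightarrow> (x + 0) powr (h * ((a + 0) / (1 + 2 * 0)))) (at_right 0)"
    proof (intro tendsto_powr' tendsto_intros)
      have "\<forall>\<^sub>F e in at_right 0. 0 \<le> x + e"
        using assms by (auto simp: eventually_at_filter intro: always_eventually)
      then show "x + 0 \<noteq> 0 \<or> 0 < h * ((a + 0) / (1 + 2 * 0)) \<and> (\<forall>\<^sub>F e in at_right 0. 0 \<le> x + e)"
        using False assms by auto
    qed auto
    moreover have "zpowr x (h * a) = x powr (h * a)"
      using False assms by (auto simp: zpowr_def)
    ultimately show ?thesis
      by simp
  qed
  moreover have "\<forall>\<^sub>F e in at_right 0. (x + e) powr (h * ((a + e) / (1 + 2 * e)))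
      = zpowr (x + e) (h * ((a + e) / (1 + 2 * e)))"
    unfolding eventually_at_filter
    by (intro always_eventually) (use assms in \<open>auto simp: zpowr_def add_nonneg_eq_0_iff\<close>)
  ultimately show ?thesis
    by (rule Lim_transform_eventually)
qed

lemma tendsto_psd_power_regularized:
  assumes "A \<in> psd_cone" and "0 \<le> a" and "0 < h"
  shows "((\<lambda>e. psd_power (A + e *\<^sub>R mat 1) (h * ((a + e) / (1 + 2 * e))))
    \<longlongrightarrow> psd_power A (h * a)) (at_right 0)"
proof -
  obtain U d where sp: "spectral U d A" and d: "\<And>i. 0 \<le> d $ i"
    using psd_spec[OF assms(1)] by metis
  have "psd_power A (h * a) = U ** diag_real (\<chi> i. zpowr (d $ i) (h * a)) ** ctranspose U"
    using spec_psd_power[OF sp] by (simp add: spectral_def)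
  moreover have "psd_power (A + e *\<^sub>R mat 1) c
      = U ** diag_real (\<chi> i. zpowr (d $ i + e) c) ** ctranspose U" for e c
    using spec_psd_power[OF spec_add_mat_1[OF sp]] by (simp add: spectral_def)
  ultimately show ?thesis
    by (simp only:) (intro tendsto_matrix_mult tendsto_diag_real tendsto_vec_lambda tendsto_const
        tendsto_zpowr_regularized assms d)
qed

lemma tendsto_lieb_matrix_regularized:
  assumes "A \<in> psd_cone" and "B \<in> psd_cone" and "0 \<le> a" and "0 \<le> b"
  shows "((\<lambda>e. lieb_matrix K ((a + e) / (1 + 2 * e)) ((b + e) / (1 + 2 * e))
      (A + e *\<^sub>R mat 1) (B + e *\<^sub>R mat 1)) \<longlongrightarrow> lieb_matrix K a b A B) (at_right 0)"
  using tendsto_psd_power_regularized[OF assms(1,3), of 1]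
    tendsto_psd_power_regularized[OF assms(2,4), of "1 / 2"]
  unfolding lieb_matrix_def by (intro tendsto_matrix_mult tendsto_const) simp_all

text \<open>Regularization of exponents and matrices. The denominator \<open>1 + 2\<epsilon>\<close> keeps the sum of the
  exponents at most 1, and adding \<open>\<epsilon>\<close> to \<open>B\<close> commutes with convex combinations. Three successive
  subsequences make the eigenvalues at the end points and at the combination converge together.\<close>

theorem smallest_sum_eigenvalues_concave:
  fixes K :: "complex^'n^'m"
  assumes ab: "0 \<le> a" "0 \<le> b" "0 < a + b" "a + b \<le> 1"
    and A: "A1 \<in> psd_cone" "A2 \<in> psd_cone" and B: "B1 \<in> psd_cone" "B2 \<in> psd_cone"
    and st: "0 \<le> s" "0 \<le> t" "s + t = 1" and k: "k \<le> CARD('n)"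
    and sp: "spectral U \<mu> (lieb_matrix K a b (s *\<^sub>R A1 + t *\<^sub>R A2) (s *\<^sub>R B1 + t *\<^sub>R B2))"
    and sp1: "spectral U1 \<mu>1 (lieb_matrix K a b A1 B1)"
    and sp2: "spectral U2 \<mu>2 (lieb_matrix K a b A2 B2)"
  shows "s * smallest_sum k (\<chi> i. \<mu>1 $ i powr (1 / (a + b))) + t * smallest_sum k (\<chi> i. \<mu>2 $ i powr (1 / (a + b)))
    \<le> smallest_sum k (\<chi> i. \<mu> $ i powr (1 / (a + b)))"
proof -
  define A0 where "A0 = s *\<^sub>R A1 + t *\<^sub>R A2"
  define B0 where "B0 = s *\<^sub>R B1 + t *\<^sub>R B2"
  have A0: "A0 \<in> psd_cone" and B0: "B0 \<in> psd_cone"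
    unfolding A0_def B0_def using A B st by (auto intro: psd_cone_combination)
  define e where "e = (\<lambda>j. inverse (real (Suc j)))"
  have e: "0 < e j" for j
    by (simp add: e_def)
  have e0: "e \<longlonglongrightarrow> 0"
    unfolding e_def by (rule LIMSEQ_inverse_real_of_nat)
  then have elim: "filterlim e (at_right 0) sequentially"
    using e by (auto simp: filterlim_at less_imp_neq[symmetric])
  define a' where "a' = (\<lambda>j. (a + e j) / (1 + 2 * e j))"
  define b' where "b' = (\<lambda>j. (b + e j) / (1 + 2 * e j))"
  define r where "r = (\<lambda>j. 1 / (a' j + b' j))"
  have ab': "0 < a' j" "0 < b' j" "a' j + b' j \<le> 1" for j
  proof -
    have "a' j + b' j = (a + b + 2 * e j) / (1 + 2 * e j)"
      by (simp add: a'_def b'_def flip: add_divide_distrib)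
    then show "a' j + b' j \<le> 1"
      using ab e[of j] by (simp add: divide_le_eq)
  qed (use ab e[of j] in \<open>auto simp: a'_def b'_def intro!: divide_pos_pos add_nonneg_pos add_pos_pos\<close>)
  have r: "r \<longlonglongrightarrow> 1 / (a + b)"
  proof -
    have "r \<longlonglongrightarrow> 1 / ((a + 0) / (1 + 2 * 0) + (b + 0) / (1 + 2 * 0))"
      unfolding r_def a'_def b'_def using ab by (intro tendsto_intros e0) auto
    then show ?thesis
      by simp
  qed
  define N where "N = (\<lambda>A B j. lieb_matrix K (a' j) (b' j) (A + e j *\<^sub>R mat 1) (B + e j *\<^sub>R mat 1))"
  have shift_psd: "C + e j *\<^sub>R mat 1 \<in> psd_cone" if "C \<in> psd_cone" for j and C :: "complex^'l^'l"
    using that e[of j] spec_add_mat_1 psd_spec[OF that] spec_psd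
    by (metis (no_types, lifting) add_nonneg_nonneg less_imp_le vec_lambda_beta)
  have Nlim: "N A B \<longlonglongrightarrow> lieb_matrix K a b A B" if "A \<in> psd_cone" "B \<in> psd_cone" for A B
    using filterlim_compose[OF tendsto_lieb_matrix_regularized[OF that ab(1,2)] elim]
    by (simp add: N_def a'_def b'_def)
  have Npsd: "N A B j \<in> psd_cone" if "A \<in> psd_cone" "B \<in> psd_cone" for A B j
    unfolding N_def by (intro lieb_matrix_psd shift_psd that)
  have "\<exists>V \<nu>. \<forall>j. spectral (V j) (\<nu> j) (N A B j) \<and> (\<forall>i. 0 \<le> \<nu> j $ i)"
    if "A \<in> psd_cone" "B \<in> psd_cone" for A B
  proof -
    have "\<forall>j. \<exists>V \<nu>. spectral V \<nu> (N A B j) \<and> (\<forall>i. 0 \<le> \<nu> $ i)"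
      using psd_spec[OF Npsd[OF that]] by metis
    then show ?thesis
      by metis
  qed
  note ex = this
  obtain V \<nu> where V: "\<And>j. spectral (V j) (\<nu> j) (N A0 B0 j)" "\<And>j i. 0 \<le> \<nu> j $ i"
    using ex[OF A0 B0] by blast
  obtain V1 \<nu>1 where V1: "\<And>j. spectral (V1 j) (\<nu>1 j) (N A1 B1 j)" "\<And>j i. 0 \<le> \<nu>1 j $ i"
    using ex[OF A(1) B(1)] by blast
  obtain V2 \<nu>2 where V2: "\<And>j. spectral (V2 j) (\<nu>2 j) (N A2 B2 j)" "\<And>j i. 0 \<le> \<nu>2 j $ i"
    using ex[OF A(2) B(2)] by blast
  have ineq: "s * smallest_sum k (\<chi> i. \<nu>1 j $ i powr r j) + t * smallest_sum k (\<chi> i. \<nu>2 j $ i powr r j)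
      \<le> smallest_sum k (\<chi> i. \<nu> j $ i powr r j)" for j
  proof -
    have "s *\<^sub>R (A1 + e j *\<^sub>R mat 1) + t *\<^sub>R (A2 + e j *\<^sub>R mat 1)
        = s *\<^sub>R A1 + t *\<^sub>R A2 + (s + t) *\<^sub>R (e j *\<^sub>R mat 1)"
      by (simp only: scaleR_add_right scaleR_add_left add_ac)
    then have A0e: "A0 + e j *\<^sub>R mat 1 = s *\<^sub>R (A1 + e j *\<^sub>R mat 1) + t *\<^sub>R (A2 + e j *\<^sub>R mat 1)"
      by (simp add: A0_def st)
    have "spectral (V j) (\<nu> j) (lieb_matrix K (a' j) (b' j)
        (s *\<^sub>R (A1 + e j *\<^sub>R mat 1) + t *\<^sub>R (A2 + e j *\<^sub>R mat 1))
        (s *\<^sub>R B1 + t *\<^sub>R B2 + e j *\<^sub>R mat 1))"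
      using V(1)[of j] unfolding N_def A0e B0_def .
    from smallest_sum_concave_shifted[OF ab' e shift_psd[OF A(1)] shift_psd[OF A(2)] B st k this
        V1(1)[of j, unfolded N_def] V2(1)[of j, unfolded N_def]]
    show ?thesis
      by (simp add: r_def)
  qed
  obtain g1 W1 \<omega>1 where g1: "strict_mono g1" "spectral W1 \<omega>1 (lieb_matrix K a b A1 B1)"
      "(\<lambda>j. \<nu>1 (g1 j)) \<longlonglongrightarrow> \<omega>1"
    using spec_subsequence_limit[OF Nlim[OF A(1) B(1)] V1(1)] by blast
  obtain g2 W2 \<omega>2 where g2: "strict_mono g2" "spectral W2 \<omega>2 (lieb_matrix K a b A2 B2)"
      "(\<lambda>j. \<nu>2 (g1 (g2 j))) \<longlonglongrightarrow> \<omega>2"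
    using spec_subsequence_limit[OF LIMSEQ_subseq_LIMSEQ[OF Nlim[OF A(2) B(2)] g1(1)],
        of "V2 \<circ> g1" "\<nu>2 \<circ> g1"] V2(1) by (auto simp: o_def)
  have g12: "strict_mono (g1 \<circ> g2)"
    using g1 g2 by (simp add: strict_mono_o)
  obtain g3 W \<omega> where g3: "strict_mono g3" "spectral W \<omega> (lieb_matrix K a b A0 B0)"
      "(\<lambda>j. \<nu> (g1 (g2 (g3 j)))) \<longlonglongrightarrow> \<omega>"
    using spec_subsequence_limit[OF LIMSEQ_subseq_LIMSEQ[OF Nlim[OF A0 B0] g12],
        of "V \<circ> (g1 \<circ> g2)" "\<nu> \<circ> (g1 \<circ> g2)"] V(1) by (auto simp: o_def)
  define g where "g = (\<lambda>j. g1 (g2 (g3 j)))"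
  have g: "strict_mono g"
    using strict_mono_o[OF g12 g3(1)] by (simp add: g_def o_def)
  have lim1: "(\<lambda>j. \<nu>1 (g j)) \<longlonglongrightarrow> \<omega>1"
    using LIMSEQ_subseq_LIMSEQ[OF g1(3) strict_mono_o[OF g2(1) g3(1)]] by (simp add: g_def o_def)
  have lim2: "(\<lambda>j. \<nu>2 (g j)) \<longlonglongrightarrow> \<omega>2"
    using LIMSEQ_subseq_LIMSEQ[OF g2(3) g3(1)] by (simp add: g_def o_def)
  have lim: "(\<lambda>j. \<nu> (g j)) \<longlonglongrightarrow> \<omega>"
    using g3(3) by (simp add: g_def)
  have rg: "(\<lambda>j. r (g j)) \<longlonglongrightarrow> 1 / (a + b)"
    using LIMSEQ_subseq_LIMSEQ[OF r g] by (simp add: o_def)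
  have smallest_sum_lim: "(\<lambda>j. smallest_sum k (\<chi> i. x j $ i powr r (g j))) \<longlonglongrightarrow> smallest_sum k (\<chi> i. x' $ i powr (1 / (a + b)))"
    if "x \<longlonglongrightarrow> x'" "\<And>j i. 0 \<le> x j $ i" for x :: "nat \<Rightarrow> real^'n" and x'
    by (intro tendsto_smallest_sum tendsto_vec_lambda tendsto_powr' tendsto_vec_nth that rg k)
       (use ab that in \<open>auto intro: always_eventually\<close>)
  have "s * smallest_sum k (\<chi> i. \<omega>1 $ i powr (1 / (a + b))) + t * smallest_sum k (\<chi> i. \<omega>2 $ i powr (1 / (a + b)))
      \<le> smallest_sum k (\<chi> i. \<omega> $ i powr (1 / (a + b)))"
    by (rule LIMSEQ_le[OF tendsto_add[OF tendsto_mult[OF tendsto_const smallest_sum_lim[OF lim1 V1(2)]]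
            tendsto_mult[OF tendsto_const smallest_sum_lim[OF lim2 V2(2)]]] smallest_sum_lim[OF lim V(2)]])
       (use ineq in blast)
  moreover have "smallest_sum k (\<chi> i. \<omega>1 $ i powr (1 / (a + b))) = smallest_sum k (\<chi> i. \<mu>1 $ i powr (1 / (a + b)))"
    by (rule smallest_sum_spec_unique[OF g1(2) sp1])
  moreover have "smallest_sum k (\<chi> i. \<omega>2 $ i powr (1 / (a + b))) = smallest_sum k (\<chi> i. \<mu>2 $ i powr (1 / (a + b)))"
    by (rule smallest_sum_spec_unique[OF g2(2) sp2])
  moreover have "smallest_sum k (\<chi> i. \<omega> $ i powr (1 / (a + b))) = smallest_sum k (\<chi> i. \<mu> $ i powr (1 / (a + b)))"
    by (rule smallest_sum_spec_unique[OF g3(2) sp[folded A0_def B0_def]])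
  ultimately show ?thesis
    by simp
qed

section \<open>Joint concavity\<close>

lemma matrix_ext_spec:
  assumes "symmetric_form \<phi>" and "spectral U d A" and "d \<in> nonneg_orthant"
  shows "matrix_ext \<phi> A = \<phi> d"
proof -
  obtain \<pi> where \<pi>: "\<pi> permutes UNIV" "\<And>i. eigenvalue_vec A $ i = d $ \<pi> i"
    using eigenvalue_vec_spec[OF assms(2)] by blast
  have "eigenvalue_vec A = (\<chi> i. d $ \<pi> i)"
    by (simp add: vec_eq_iff \<pi>(2))
  with assms \<pi>(1) show ?thesis
    by (simp add: matrix_ext_def symmetric_form_def)
qed

text \<open>Jensen's inequality for the inverse power \<open>1/r \<ge> 1\<close>.\<close>

lemma powr_concave_ineq:
  fixes x y u v r :: real
  assumes "0 \<le> x" "0 \<le> y" "0 \<le> u" "0 \<le> v" "u + v = 1" "0 < r" "r \<le> 1"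
  shows "u * x powr r + v * y powr r \<le> (u * x + v * y) powr r"
proof -
  let ?m = "u * x powr r + v * y powr r"
  have "?m powr (1 / r) \<le> u * (x powr r) powr (1 / r) + v * (y powr r) powr (1 / r)"
    using powr_jensen[of "{True, False}" "\<lambda>c. if c then u else v"
        "\<lambda>c. if c then x powr r else y powr r" "1 / r"] assms by simp
  also have "\<dots> = u * x + v * y"
    using assms by (simp add: powr_powr)
  finally have "(?m powr (1 / r)) powr r \<le> (u * x + v * y) powr r"
    using assms by (intro powr_mono2) auto
  then show ?thesis
    using assms by (simp add: powr_powr)
qed

text \<open>This absorbs the factor \<open>p + q\<close> of the exponent into the symmetric form.\<close>

lemma symmetric_concave_comp_powr:
  fixes \<phi> :: "real^'n \<Rightarrow> real"
  assumes sym: "symmetric_form \<phi>" and mono: "mono_on nonneg_orthant \<phi>"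
    and conc: "concave_on nonneg_orthant \<phi>" and r: "0 < r" "r \<le> 1"
  defines "\<psi> \<equiv> \<lambda>x. \<phi> (\<chi> i. x $ i powr r)"
  shows "symmetric_form \<psi>" and "mono_on nonneg_orthant \<psi>" and "concave_on nonneg_orthant \<psi>"
proof -
  have orth: "(\<chi> i. x $ i powr r) \<in> nonneg_orthant" for x :: "real^'n"
    by (simp add: nonneg_orthant_def)
  show "symmetric_form \<psi>"
    unfolding symmetric_form_def \<psi>_def
  proof (intro ballI allI impI)
    fix x :: "real^'n" and \<pi> :: "'n \<Rightarrow> 'n" assume "\<pi> permutes UNIV"
    then show "\<phi> (\<chi> i. (\<chi> i. x $ \<pi> i) $ i powr r) = \<phi> (\<chi> i. x $ i powr r)"
      using sym[unfolded symmetric_form_def, rule_format, OF orth[of x], of \<pi>] by simp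
  qed
  show "mono_on nonneg_orthant \<psi>"
    unfolding \<psi>_def using r
    by (intro mono_onI mono_onD[OF mono] orth)
       (auto simp: less_eq_vec_def nonneg_orthant_def intro!: powr_mono2)
  have cvx: "convex (nonneg_orthant :: (real^'n) set)"
    using conc by (simp add: concave_on_iff)
  show "concave_on nonneg_orthant \<psi>"
    unfolding concave_on_iff
  proof (intro conjI ballI allI impI cvx)
    fix x y :: "real^'n" and u v :: real
    assume xy: "x \<in> nonneg_orthant" "y \<in> nonneg_orthant" and uv: "0 \<le> u" "0 \<le> v" "u + v = 1"
    have "u * \<psi> x + v * \<psi> y \<le> \<phi> (u *\<^sub>R (\<chi> i. x $ i powr r) + v *\<^sub>R (\<chi> i. y $ i powr r))"
      using conc orth uv by (simp add: concave_on_iff \<psi>_def)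
    also have "\<dots> \<le> \<psi> (u *\<^sub>R x + v *\<^sub>R y)"
      unfolding \<psi>_def
    proof (rule mono_onD[OF mono])
      show "u *\<^sub>R (\<chi> i. x $ i powr r) + v *\<^sub>R (\<chi> i. y $ i powr r)
          \<le> (\<chi> i. (u *\<^sub>R x + v *\<^sub>R y) $ i powr r)"
        using xy uv r by (simp add: less_eq_vec_def nonneg_orthant_def powr_concave_ineq)
      show "u *\<^sub>R (\<chi> i. x $ i powr r) + v *\<^sub>R (\<chi> i. y $ i powr r) \<in> nonneg_orthant"
        using uv by (simp add: nonneg_orthant_def)
    qed (rule orth)
    finally show "u * \<psi> x + v * \<psi> y \<le> \<psi> (u *\<^sub>R x + v *\<^sub>R y)" .
  qed
qed

theorem theorem2p5:
  fixes \<phi> :: "real^'n \<Rightarrow> real" and K :: "complex^'n^'m" and s p q :: real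
  assumes "symmetric_form \<phi>"
    and "mono_on nonneg_orthant \<phi>"
    and "concave_on nonneg_orthant \<phi>"
    and "0 < s" and "s \<le> 1"
    and "0 \<le> p" and "p \<le> 1"
    and "0 \<le> q" and "q \<le> 1"
    and "p + q \<le> 1"
  shows "concave_on ((psd_cone :: (complex^'m^'m) set) \<times> (psd_cone :: (complex^'n^'n) set))
    (\<lambda>(A, B). matrix_ext \<phi>
      (psd_power
        (psd_power B (q * s / 2) ** ctranspose K ** psd_power A (p * s) ** K ** psd_power B (q * s / 2))
        (1 / s)))"
proof -
  define F where "F = (\<lambda>A B. matrix_ext \<phi> (psd_power (lieb_matrix K (p * s) (q * s) A B) (1 / s)))"
  have "u * F A1 B1 + v * F A2 B2 \<le> F (u *\<^sub>R A1 + v *\<^sub>R A2) (u *\<^sub>R B1 + v *\<^sub>R B2)"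
    if A: "A1 \<in> psd_cone" "A2 \<in> psd_cone" and B: "B1 \<in> psd_cone" "B2 \<in> psd_cone"
      and uv: "0 \<le> u" "0 \<le> v" "u + v = 1" for A1 A2 B1 B2 u v
  \<comment> \<open>For \<open>p = q = 0\<close> the powers of \<open>A\<close> and \<open>B\<close> are identity matrices and the function is constant.\<close>
  proof (cases "p + q = 0")
    case True
    then have "p = 0" "q = 0"
      using assms by auto
    then have "F A B = matrix_ext \<phi> (psd_power (ctranspose K ** K) (1 / s))"
      if "A \<in> psd_cone" "B \<in> psd_cone" for A B
      using that by (simp add: F_def lieb_matrix_def psd_power_0)
    with A B uv psd_cone_combination[OF A uv] psd_cone_combination[OF B uv] show ?thesis
      by (simp flip: distrib_right)
  next
    case False
    define r where "r = p + q"
    have r: "0 < r" "r \<le> 1"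
      using False assms by (auto simp: r_def)
    define a where "a = p * s"
    define b where "b = q * s"
    have abr: "a + b = r * s"
      by (simp add: a_def b_def r_def distrib_right)
    have ab: "0 \<le> a" "0 \<le> b" "0 < a + b" "a + b \<le> 1"
      using assms r by (simp_all add: abr mult_le_one) (simp_all add: a_def b_def)
    define \<psi> where "\<psi> = (\<lambda>x :: real^'n. \<phi> (\<chi> i. x $ i powr r))"
    have \<psi>: "symmetric_form \<psi>" "mono_on nonneg_orthant \<psi>" "concave_on nonneg_orthant \<psi>"
      unfolding \<psi>_def using symmetric_concave_comp_powr[OF assms(1-3) r] by auto
    have F: "F A B = \<psi> (\<chi> i. \<mu> $ i powr (1 / (a + b)))"
      if sp: "spectral U \<mu> (lieb_matrix K a b A B)" for U \<mu> A B
    proof -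
      have "zpowr (\<mu> $ i) (1 / s) = (\<mu> $ i powr (1 / (a + b))) powr r" for i
        using r assms by (simp add: zpowr_def powr_powr abr)
      then have "\<psi> (\<chi> i. \<mu> $ i powr (1 / (a + b))) = \<phi> (\<chi> i. zpowr (\<mu> $ i) (1 / s))"
        by (simp add: \<psi>_def)
      also have "\<dots> = F A B"
        unfolding F_def a_def[symmetric] b_def[symmetric]
        using matrix_ext_spec[OF assms(1) spec_psd_power[OF sp]]
        by (simp add: nonneg_orthant_def)
      finally show ?thesis
        by simp
    qed
    obtain U1 \<mu>1 where sp1: "spectral U1 \<mu>1 (lieb_matrix K a b A1 B1)"
      using psd_spec[OF lieb_matrix_psd[OF A(1) B(1)]] by metis
    obtain U2 \<mu>2 where sp2: "spectral U2 \<mu>2 (lieb_matrix K a b A2 B2)"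
      using psd_spec[OF lieb_matrix_psd[OF A(2) B(2)]] by metis
    obtain U \<mu> where sp: "spectral U \<mu> (lieb_matrix K a b (u *\<^sub>R A1 + v *\<^sub>R A2) (u *\<^sub>R B1 + v *\<^sub>R B2))"
      using psd_spec[OF lieb_matrix_psd[OF psd_cone_combination[OF A uv] psd_cone_combination[OF B uv]]]
      by metis
    show ?thesis
      unfolding F[OF sp] F[OF sp1] F[OF sp2]
      by (rule symmetric_concave_of_smallest_sum_concave[OF \<psi> _ _ _ uv])
         (auto simp: nonneg_orthant_def intro: smallest_sum_eigenvalues_concave[OF ab A B uv _ sp sp1 sp2])
  qed
  then have "concave_on (psd_cone \<times> psd_cone) (\<lambda>(A, B). F A B)"
    unfolding concave_on_iff by (auto intro: convex_Times convex_psd_cone)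
  then show ?thesis
    by (simp add: F_def lieb_matrix_def)
qed

end
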